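(* Let $\vec\beta$ be in the high temperature (sub-critical) phase, with $p^*$ the unique solution of $\varphi_{\vec\beta}(p)=p$. There exists a constant $C>0$, independent of $n$, such that for all sufficiently large $n$, $$W_1(\pi,\nu)\le C\,n^{3/2}\sqrt{\log n},$$ where $\pi$ is the $\mathrm{ERGM}(\vec\beta)$ distribution on $\mathcal G_n$ and $\nu$ is the law on $\mathcal G_n$ of the Erdős–Rényi random graph $G(n,p^* )$.
   Context: Configurations. $\mathcal G_n$ is the set of simple graphs on vertex set $\{1,\dots,n\}$, identified with $\{0,1\}^M$, $M=n(n-1)/2$, with coordinates indexed by the edges of the complete graph $K_n$: $x=(x_e)_{e\in E(K_n)}$, $x_e=1$ iff $e$ is present. ERGM. Fix $s\ge1$, finite simple graphs $G_1,\dots,G_s$ with $|V_i|$ vertices and $|E_i|$ edges, and $\vec\beta=(\beta_1,\dots,\beta_s)$ with all $\beta_i>0$ (all independent of $n$). For a graph $G$, $N_G(x)=\sum_{\psi}\prod_{(v,w)\in E(G)}x_{(\psi(v),\psi(w))}$, the sum over all injective $\psi:V(G)\to\{1,\dots,n\}$. The Hamiltonian is $H(x)=\sum_{i=1}^s\beta_i N_{G_i}(x)/n^{|V_i|-2}$, and $\mathrm{ERGM}(\vec\beta)$ is the probability measure $\pi=\pi_n$ on $\mathcal G_n$ with $\pi(x)\propto e^{H(x)}$. High temperature phase. Let $\Phi(u)=e^u/(1+e^u)$ and, for $p>0$, $\Psi_{\vec\beta}(p)=\sum_{i=1}^s2\beta_i|E_i|p^{|E_i|-1}$ and $\varphi_{\vec\beta}(p)=\Phi(\Psi_{\vec\beta}(p))$.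 $\vec\beta$ is in the high temperature (sub-critical) phase if $\varphi_{\vec\beta}(p)=p$ has a unique solution $p^*$ and $\varphi_{\vec\beta}'(p^* )<1$. Wasserstein distance. For probability measures $\mu,\nu$ on $\mathcal G_n$, $W_1(\mu,\nu)=\inf_\Gamma\sum_{e\in E(K_n)}\mathbb P_\Gamma(X_e\ne Y_e)$, the infimum over all couplings $\Gamma$ of $\mu$ and $\nu$, with $(X,Y)\sim\Gamma$. *)

theory Defs
  imports "HOL-Probability.Probability" "HOL-Library.Ramsey"
begin

section \<open>Graphs and configurations\<close>

type_synonym 'v graph = "'v set \<times> 'v set set"

abbreviation vertices :: "'v graph \<Rightarrow> 'v set" where
  "vertices \<equiv> fst"

abbreviation edges :: "'v graph \<Rightarrow> 'v set set" where
  "edges \<equiv> snd"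

definition finite_simple_graph :: "'v graph \<Rightarrow> bool" where
  "finite_simple_graph G \<longleftrightarrow> finite (vertices G) \<and> edges G \<subseteq> nsets (vertices G) 2"

definition complete_edges :: "nat \<Rightarrow> nat set set" where
  "complete_edges n = nsets {1..n} 2"

text \<open>
  Elements of $\{0,1\}^{E(K_n)}$ are total functions that take the default value \<^term>\<open>False\<close>
  outside \<^term>\<open>complete_edges n\<close>; this is the convention of \<^const>\<open>Pi_pmf\<close>.
\<close>

type_synonym config = "nat set \<Rightarrow> bool"

definition configs :: "nat \<Rightarrow> config set" where
  "configs n = PiE_dflt (complete_edges n) False (\<lambda>_. UNIV)"

section \<open>Exponential random graphs and Erdos-Renyi graphs\<close>

definition inj_hom_count :: "nat \<Rightarrow> 'v graph \<Rightarrow> config \<Rightarrow> real" where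
  "inj_hom_count n G x =
    (\<Sum>\<psi> \<in> {\<psi> \<in> vertices G \<rightarrow>\<^sub>E {1..n}. inj_on \<psi> (vertices G)}.
       \<Prod>e\<in>edges G. of_bool (x (\<psi> ` e)))"

text \<open>The exponent $|V_i| - 2$ is an integer, possibly negative.\<close>

definition hamiltonian ::
    "nat \<Rightarrow> (nat \<Rightarrow> 'v graph) \<Rightarrow> (nat \<Rightarrow> real) \<Rightarrow> nat \<Rightarrow> config \<Rightarrow> real" where
  "hamiltonian s G \<beta> n x =
    (\<Sum>i=1..s. \<beta> i * inj_hom_count n (G i) x / real n powi (int (card (vertices (G i))) - 2))"

definition partition_function ::
    "nat \<Rightarrow> (nat \<Rightarrow> 'v graph) \<Rightarrow> (nat \<Rightarrow> real) \<Rightarrow> nat \<Rightarrow> real" where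
  "partition_function s G \<beta> n = (\<Sum>x\<in>configs n. exp (hamiltonian s G \<beta> n x))"

definition ergm :: "nat \<Rightarrow> (nat \<Rightarrow> 'v graph) \<Rightarrow> (nat \<Rightarrow> real) \<Rightarrow> nat \<Rightarrow> config pmf" where
  "ergm s G \<beta> n = embed_pmf (\<lambda>x. if x \<in> configs n
     then exp (hamiltonian s G \<beta> n x) / partition_function s G \<beta> n else 0)"

definition erdos_renyi :: "nat \<Rightarrow> real \<Rightarrow> config pmf" where
  "erdos_renyi n p = Pi_pmf (complete_edges n) False (\<lambda>_. bernoulli_pmf p)"

section \<open>High temperature phase\<close>

definition logistic :: "real \<Rightarrow> real" where
  "logistic u = exp u / (1 + exp u)"

text \<open>
  For an edgeless $G_i$ the truncated exponent is harmless, since the factor $|E_i|$ vanishes.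
\<close>

definition ergm_Psi :: "nat \<Rightarrow> (nat \<Rightarrow> 'v graph) \<Rightarrow> (nat \<Rightarrow> real) \<Rightarrow> real \<Rightarrow> real" where
  "ergm_Psi s G \<beta> p =
    (\<Sum>i=1..s. 2 * \<beta> i * real (card (edges (G i))) * p ^ (card (edges (G i)) - 1))"

definition ergm_phi :: "nat \<Rightarrow> (nat \<Rightarrow> 'v graph) \<Rightarrow> (nat \<Rightarrow> real) \<Rightarrow> real \<Rightarrow> real" where
  "ergm_phi s G \<beta> p = logistic (ergm_Psi s G \<beta> p)"

definition unique_fixed_point ::
    "nat \<Rightarrow> (nat \<Rightarrow> 'v graph) \<Rightarrow> (nat \<Rightarrow> real) \<Rightarrow> real \<Rightarrow> bool" where
  "unique_fixed_point s G \<beta> p \<longleftrightarrow>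
     p > 0 \<and> ergm_phi s G \<beta> p = p \<and> (\<forall>q>0. ergm_phi s G \<beta> q = q \<longrightarrow> q = p)"

definition high_temperature :: "nat \<Rightarrow> (nat \<Rightarrow> 'v graph) \<Rightarrow> (nat \<Rightarrow> real) \<Rightarrow> bool" where
  "high_temperature s G \<beta> \<longleftrightarrow>
     (\<exists>p. unique_fixed_point s G \<beta> p \<and> deriv (ergm_phi s G \<beta>) p < 1)"

section \<open>Wasserstein distance\<close>

definition couplings :: "'a pmf \<Rightarrow> 'b pmf \<Rightarrow> ('a \<times> 'b) pmf set" where
  "couplings \<mu> \<nu> = {\<Gamma>. map_pmf fst \<Gamma> = \<mu> \<and> map_pmf snd \<Gamma> = \<nu>}"

definition wasserstein :: "nat \<Rightarrow> config pmf \<Rightarrow> config pmf \<Rightarrow> real" where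
  "wasserstein n \<mu> \<nu> =
    (INF \<Gamma>\<in>couplings \<mu> \<nu>. \<Sum>e\<in>complete_edges n. measure_pmf.prob \<Gamma> {(x, y). x e \<noteq> y e})"

section \<open>Well-definedness\<close>

lemma finite_complete_edges [simp, intro]: "finite (complete_edges n)"
  by (simp add: complete_edges_def finite_imp_finite_nsets)

lemma finite_configs [simp, intro]: "finite (configs n)"
  by (auto simp: configs_def)

lemma configs_nonempty: "configs n \<noteq> {}"
proof -
  have "(\<lambda>_. False) \<in> configs n"
    by (simp add: configs_def PiE_dflt_def)
  then show ?thesis by blast
qed

lemma card_complete_edges: "card (complete_edges n) = n choose 2"
  by (simp add: complete_edges_def)

lemma partition_function_pos: "partition_function s G \<beta> n > 0"
  unfolding partition_function_def by (intro sum_pos configs_nonempty) auto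

lemma pmf_ergm:
  "pmf (ergm s G \<beta> n) x = (if x \<in> configs n
     then exp (hamiltonian s G \<beta> n x) / partition_function s G \<beta> n else 0)"
  (is "_ = ?f x")
  unfolding ergm_def
proof (rule pmf_embed_pmf)
  show nonneg: "0 \<le> ?f y" for y
    using partition_function_pos[of s G \<beta> n] by auto
  have "(\<integral>\<^sup>+ y. ennreal (?f y) \<partial>count_space UNIV) = (\<Sum>y\<in>configs n. ennreal (?f y))"
    by (subst nn_integral_count_space'[of "configs n"]) auto
  also have "\<dots> = ennreal (\<Sum>y\<in>configs n. ?f y)"
    using nonneg by (intro sum_ennreal) blast
  also have "(\<Sum>y\<in>configs n. ?f y) = 1"
    using partition_function_pos[of s G \<beta> n]
    by (simp add: sum_divide_distrib [symmetric] flip: partition_function_def)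
  finally show "(\<integral>\<^sup>+ y. ennreal (?f y) \<partial>count_space UNIV) = 1" by simp
qed

lemma set_pmf_ergm: "set_pmf (ergm s G \<beta> n) = configs n"
  using partition_function_pos[of s G \<beta> n]
  by (auto simp: set_pmf_eq pmf_ergm)

lemma set_pmf_erdos_renyi: "set_pmf (erdos_renyi n p) \<subseteq> configs n"
  unfolding erdos_renyi_def configs_def
  by (rule order.trans[OF set_Pi_pmf_subset']) (auto simp: PiE_dflt_def)

lemma pair_pmf_in_couplings: "pair_pmf \<mu> \<nu> \<in> couplings \<mu> \<nu>"
  by (simp add: couplings_def map_fst_pair_pmf map_snd_pair_pmf)

lemma wasserstein_le:
  assumes "\<Gamma> \<in> couplings \<mu> \<nu>"
  shows "wasserstein n \<mu> \<nu> \<le> (\<Sum>e\<in>complete_edges n. measure_pmf.prob \<Gamma> {(x, y). x e \<noteq> y e})"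
  unfolding wasserstein_def using assms
  by (intro cINF_lower bdd_belowI[of _ 0]) (auto intro!: sum_nonneg)

end

theory Submission
  imports Defs
begin

text \<open>
  Both laws are stationary for heat-bath dynamics, so resampling the edges one at a time couples
  the ERGM with $G(n,q)$ such that edge $e$ violates $X_e \le Y_e$ with probability
  $E_\pi (\Phi(\partial_e H) - q)^+$. If the total violation at $q$ is small, then by monotonicity
  $\partial_e H(X) \le \partial_e H(Y)$, and McDiarmid's inequality in $G(n,q)$ bounds
  $\partial_e H(Y)$ by $\Psi(q) + t$ up to probability $e^{-c n t^2}$; hence the violation is small
  at any $q' \ge \Phi(\Psi(q) + t)$. Starting from $q = 1$ and choosing $t$ proportional to
  $q - p^*$, this drives $q$ geometrically down to $p^* + O(\sqrt{\log n / n})$. The same argument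
  from $q = 0$ upwards gives $E_\pi |\Phi(\partial_e H) - p^*| = O(\sqrt{\log n / n})$ for every
  edge, and the coupling at $q = p^*$ yields the bound.
\<close>

section \<open>Heat-bath couplings\<close>

text \<open>Concentration is available in the product measure but not, in advance, in the ERGM; the
  order X \<le> Y transfers tail bounds from the former to the latter. This needs
  \<open>\<partial>_e H\<close> to be increasing, which is where positivity of the \<beta>_i enters.
  The phase condition enters as a one-dimensional fact: uniqueness of the fixed point p together
  with slope below 1 at p makes \<open>ergm_phi\<close> contract towards p on all of [0,1], so
  neither the descent from q = 1 nor the ascent from q = 0 can stall early. Each round turns the
  total violation into a bound for every single edge and sums again, at the price of a factor n^2.
  This is affordable only while n (q - p)^2 is at least a multiple of log n, which fixes the
  stopping distance sqrt(log n / n). There the total violation is at most 1, and moving q the rest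
  of the way to p costs at most that distance for each of at most n^2 edges: n^2 sqrt(log n / n) =
  n^(3/2) sqrt(log n).\<close>

lemma bernoulli_coupling:
  assumes "0 \<le> p" "p \<le> 1" "0 \<le> q" "q \<le> 1"
  shows "\<exists>J. map_pmf fst J = bernoulli_pmf p \<and> map_pmf snd J = bernoulli_pmf q \<and>
    pmf J (True, False) = max (p - q) 0 \<and> pmf J (False, True) = max (q - p) 0"
proof -
  \<comment> \<open>The joint law of the indicators of U < p and U < q for one uniform variable U on
    [0,1].\<close>
  define f where "f = (\<lambda>(a, b). if a then if b then min p q else max (p - q) 0
    else if b then max (q - p) 0 else 1 - max p q)"
  have U: "(UNIV :: (bool \<times> bool) set) = {(True, True), (True, False), (False, True), (False, False)}"
    by auto
  have nonneg: "f z \<ge> 0" for z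
    using assms by (auto simp: f_def split: prod.splits)
  have "(\<Sum>z\<in>UNIV. f z) = 1"
    by (simp add: U f_def)
  then have "(\<integral>\<^sup>+ z. ennreal (f z) \<partial>count_space UNIV) = 1"
    using nonneg by (simp add: nn_integral_count_space_finite sum_ennreal)
  then have J: "pmf (embed_pmf f) z = f z" for z
    by (intro pmf_embed_pmf nonneg)
  have fst: "fst -` {a} = {(a, True), (a, False)}"
    and snd: "snd -` {a} = {(True, a), (False, a)}" for a :: bool
  proof -
    have "z \<in> fst -` {a} \<longleftrightarrow> z \<in> {(a, True), (a, False)}"
      and "z \<in> snd -` {a} \<longleftrightarrow> z \<in> {(True, a), (False, a)}" for z
      by (cases z; auto)+
    then show "fst -` {a} = {(a, True), (a, False)}" "snd -` {a} = {(True, a), (False, a)}"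
      by (simp_all only: set_eq_iff simp_thms)
  qed
  have "pmf (map_pmf fst (embed_pmf f)) a = f (a, True) + f (a, False)"
    and "pmf (map_pmf snd (embed_pmf f)) a = f (True, a) + f (False, a)" for a
    by (simp_all add: pmf_map fst snd measure_measure_pmf_finite J)
  then have "pmf (map_pmf fst (embed_pmf f)) a = pmf (bernoulli_pmf p) a"
    and "pmf (map_pmf snd (embed_pmf f)) a = pmf (bernoulli_pmf q) a" for a
    using assms by (cases a; simp add: f_def)+
  then have "map_pmf fst (embed_pmf f) = bernoulli_pmf p" "map_pmf snd (embed_pmf f) = bernoulli_pmf q"
    by (auto intro: pmf_eqI)
  then show ?thesis
    using J by (intro exI[of _ "embed_pmf f"]) (auto simp: f_def)
qed

definition heat_bath :: "(('i \<Rightarrow> bool) \<Rightarrow> real) \<Rightarrow> 'i \<Rightarrow> ('i \<Rightarrow> bool) \<Rightarrow> ('i \<Rightarrow> bool) pmf" where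
  "heat_bath g e x = map_pmf (\<lambda>b. x(e := b)) (bernoulli_pmf (g x))"

text \<open>Resampling at \<open>e\<close> stays within the fibre
  \<open>{z(e := True), z(e := False)}\<close>, on which \<open>g\<close> is constant, and
  \<open>balance\<close> says that \<open>\<mu>\<close> already splits the mass of this fibre in the
  ratio \<open>g z\<close> to \<open>1 - g z\<close>.\<close>

lemma heat_bath_invariant:
  assumes g: "\<And>x. 0 \<le> g x \<and> g x \<le> 1" "\<And>x b. g (x(e := b)) = g x"
    and balance: "\<And>x. pmf \<mu> (x(e := True)) * (1 - g x) = pmf \<mu> (x(e := False)) * g x"
  shows "bind_pmf \<mu> (heat_bath g e) = \<mu>"
proof (rule pmf_eqI)
  fix z
  let ?A = "{z(e := True), z(e := False)}"
  have *: "pmf (heat_bath g e x) z = pmf (bernoulli_pmf (g z)) (z e) * indicator ?A x" for x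
  proof (cases "x \<in> ?A")
    case True
    then have "g x = g z" using g(2) by auto
    moreover have "(\<lambda>b. x(e := b)) -` {z} = {z e}"
      using True by (auto simp: fun_eq_iff)
    ultimately show ?thesis
      using True by (simp add: heat_bath_def pmf_map measure_pmf_single)
  next
    case False
    have "x(e := b) \<noteq> z" for b
    proof
      assume "x(e := b) = z"
      then have "x = z(e := x e)" by auto
      then show False using False by (cases "x e") auto
    qed
    then have "(\<lambda>b. x(e := b)) -` {z} = {}" by auto
    then show ?thesis
      using False by (simp add: heat_bath_def pmf_map)
  qed
  have ne: "z(e := True) \<noteq> z(e := False)"
    by (metis fun_upd_same)
  have "pmf (bind_pmf \<mu> (heat_bath g e)) z
      = pmf (bernoulli_pmf (g z)) (z e) * measure_pmf.prob \<mu> ?A"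
    by (simp add: pmf_bind *)
  also have "measure_pmf.prob \<mu> ?A = pmf \<mu> (z(e := True)) + pmf \<mu> (z(e := False))"
    using ne by (simp add: measure_measure_pmf_finite)
  also have "pmf (bernoulli_pmf (g z)) (z e) * \<dots> = pmf \<mu> z"
    using balance[of z] g(1)[of z] 
    by (cases "z e") (auto simp: algebra_simps fun_upd_idem)
  finally show "pmf (bind_pmf \<mu> (heat_bath g e)) z = pmf \<mu> z" .
qed

text \<open>
  Starting from the independent coupling, the edges are resampled one after the other, each time
  with the optimal coupling of the two conditional laws. Both marginals are stationary, so the
  law of a coordinate is settled at its only update.
\<close>

lemma heat_bath_sweep:
  fixes \<mu> \<nu> :: "('i \<Rightarrow> bool) pmf"
  assumes "finite F"
    and g: "\<And>e x. e \<in> F \<Longrightarrow> 0 \<le> g e x \<and> g e x \<le> 1"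
    and q: "0 \<le> q" "q \<le> 1"
    and \<mu>: "\<And>e. e \<in> F \<Longrightarrow> bind_pmf \<mu> (heat_bath (g e) e) = \<mu>"
    and \<nu>: "\<And>e. e \<in> F \<Longrightarrow> bind_pmf \<nu> (heat_bath (\<lambda>_. q) e) = \<nu>"
  shows "\<exists>\<Gamma>\<in>couplings \<mu> \<nu>. \<forall>e\<in>F.
    pmf (map_pmf (\<lambda>(x, y). (x e, y e)) \<Gamma>) (True, False)
      = measure_pmf.expectation \<mu> (\<lambda>x. max (g e x - q) 0) \<and>
    pmf (map_pmf (\<lambda>(x, y). (x e, y e)) \<Gamma>) (False, True)
      = measure_pmf.expectation \<mu> (\<lambda>x. max (q - g e x) 0)"
  using assms(1) g \<mu> \<nu>
proof (induction F rule: finite_induct)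
  case empty
  then show ?case using pair_pmf_in_couplings by blast
next
  case (insert e F)
  then obtain \<Gamma> where \<Gamma>: "\<Gamma> \<in> couplings \<mu> \<nu>"
    and IH: "\<And>f. f \<in> F \<Longrightarrow> pmf (map_pmf (\<lambda>(x, y). (x f, y f)) \<Gamma>) (True, False)
        = measure_pmf.expectation \<mu> (\<lambda>x. max (g f x - q) 0)"
      "\<And>f. f \<in> F \<Longrightarrow> pmf (map_pmf (\<lambda>(x, y). (x f, y f)) \<Gamma>) (False, True)
        = measure_pmf.expectation \<mu> (\<lambda>x. max (q - g f x) 0)"
    by (metis insertCI)
  have "\<forall>x. \<exists>J. map_pmf fst J = bernoulli_pmf (g e x) \<and> map_pmf snd J = bernoulli_pmf q \<and>
    pmf J (True, False) = max (g e x - q) 0 \<and> pmf J (False, True) = max (q - g e x) 0"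
    using insert.prems(1) q by (intro allI bernoulli_coupling) auto
  then obtain J where J: "\<And>x. map_pmf fst (J x) = bernoulli_pmf (g e x)"
      "\<And>x. map_pmf snd (J x) = bernoulli_pmf q"
      "\<And>x. pmf (J x) (True, False) = max (g e x - q) 0"
      "\<And>x. pmf (J x) (False, True) = max (q - g e x) 0"
    by metis
  define K where "K = (\<lambda>(x, y). map_pmf (\<lambda>(a, b). (x(e := a), y(e := b))) (J x))"
  define \<Gamma>' where "\<Gamma>' = bind_pmf \<Gamma> K"
  have fst: "map_pmf fst \<Gamma> = \<mu>" and snd: "map_pmf snd \<Gamma> = \<nu>"
    using \<Gamma> by (auto simp: couplings_def)
  have "map_pmf fst (K z) = heat_bath (g e) e (fst z)" for z
    by (cases z) (simp add: K_def heat_bath_def pmf.map_comp o_def case_prod_beta flip: J(1))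
  then have "map_pmf fst \<Gamma>' = bind_pmf (map_pmf fst \<Gamma>) (heat_bath (g e) e)"
    by (simp add: \<Gamma>'_def map_bind_pmf bind_map_pmf)
  moreover have "map_pmf snd (K z) = heat_bath (\<lambda>_. q) e (snd z)" for z
    by (cases z)
       (simp add: K_def heat_bath_def pmf.map_comp o_def case_prod_beta flip: J(2)[of "fst z"])
  then have "map_pmf snd \<Gamma>' = bind_pmf (map_pmf snd \<Gamma>) (heat_bath (\<lambda>_. q) e)"
    by (simp add: \<Gamma>'_def map_bind_pmf bind_map_pmf)
  ultimately have coupling: "\<Gamma>' \<in> couplings \<mu> \<nu>"
    using insert.prems(2,3)[of e] fst snd by (simp add: couplings_def)
  have same: "map_pmf (\<lambda>(x, y). (x f, y f)) (K z) = return_pmf (fst z f, snd z f)"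
    if "f \<noteq> e" for f z
    using that by (cases z) (simp add: K_def pmf.map_comp o_def case_prod_beta)
  have "map_pmf (\<lambda>(x, y). (x f, y f)) \<Gamma>' = map_pmf (\<lambda>(x, y). (x f, y f)) \<Gamma>"
    if "f \<in> F" for f
  proof -
    have "f \<noteq> e" using that insert.hyps(2) by auto
    then have "K z \<bind> (\<lambda>z. return_pmf (fst z f, snd z f)) = return_pmf (fst z f, snd z f)" for z
      using same by (simp add: map_pmf_def case_prod_beta')
    then show ?thesis
      by (simp add: \<Gamma>'_def map_pmf_def bind_assoc_pmf case_prod_beta')
  qed
  moreover have "map_pmf (\<lambda>(x, y). (x e, y e)) (K z) = J (fst z)" for z
    by (cases z) (simp add: K_def pmf.map_comp o_def case_prod_beta)
  \<comment> \<open>The kernel \<open>J\<close> looks only at the first component, because the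
    second rate is the constant \<open>q\<close>. So the new pair at \<open>e\<close> depends on
    \<open>\<Gamma>\<close> only through its first marginal \<open>\<mu>\<close>, whatever the
    dependence between the components.\<close>
  then have "map_pmf (\<lambda>(x, y). (x e, y e)) \<Gamma>' = bind_pmf (map_pmf fst \<Gamma>) J"
    by (simp add: \<Gamma>'_def map_bind_pmf bind_map_pmf)
  then have "map_pmf (\<lambda>(x, y). (x e, y e)) \<Gamma>' = bind_pmf \<mu> J"
    by (simp add: fst)
  ultimately show ?case
    using IH insert.hyps(2) coupling
    by (intro bexI[of _ \<Gamma>'] ballI, elim insertE) (simp_all add: pmf_bind J)
qed

section \<open>A bounded differences inequality\<close>

text \<open>Hoeffding's lemma for a two-point variable. Factoring out the smaller exponential leaves
  the one-variable inequality for the log moment generating function; the order of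
  \<open>l * a\<close> and \<open>l * b\<close> is handled by exchanging \<open>q\<close> and
  \<open>1 - q\<close>.\<close>

lemma bernoulli_mgf:
  fixes q a b l :: real
  assumes "0 \<le> q" "q \<le> 1"
  shows "q * exp (l * a) + (1 - q) * exp (l * b)
    \<le> exp (l * (q * a + (1 - q) * b) + l\<^sup>2 * (a - b)\<^sup>2 / 8)"
proof -
  have *: "q * exp u + (1 - q) * exp v \<le> exp (q * u + (1 - q) * v + (u - v)\<^sup>2 / 8)"
    if "0 \<le> q" "q \<le> 1" "u \<ge> v" for q u v :: real
  proof -
    have pos: "1 + q * (exp (u - v) - 1) > 0"
      using that by (intro add_pos_nonneg mult_nonneg_nonneg) auto
    have "- (u - v) * q + ln (1 + q * (exp (u - v) - 1)) \<le> (u - v)\<^sup>2 / 8"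
      using Hoeffdings_lemma_aux[of "u - v" q] that by simp
    then have "ln (1 + q * (exp (u - v) - 1)) \<le> (u - v) * q + (u - v)\<^sup>2 / 8"
      by linarith
    then have "1 + q * (exp (u - v) - 1) \<le> exp ((u - v) * q + (u - v)\<^sup>2 / 8)"
      using pos by (metis exp_le_cancel_iff exp_ln)
    then have "exp v * (1 + q * (exp (u - v) - 1)) \<le> exp v * exp ((u - v) * q + (u - v)\<^sup>2 / 8)"
      by simp
    also have "exp v * (1 + q * (exp (u - v) - 1)) = q * exp u + (1 - q) * exp v"
      by (simp add: exp_diff field_simps)
    also have "exp v * exp ((u - v) * q + (u - v)\<^sup>2 / 8)
        = exp (q * u + (1 - q) * v + (u - v)\<^sup>2 / 8)"
      by (simp add: algebra_simps flip: exp_add)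
    finally show ?thesis .
  qed
  have sq: "(l * a - l * b)\<^sup>2 = l\<^sup>2 * (a - b)\<^sup>2" "(l * b - l * a)\<^sup>2 = l\<^sup>2 * (a - b)\<^sup>2"
    by (simp_all add: power2_eq_square algebra_simps)
  show ?thesis
  proof (cases "l * a \<ge> l * b")
    case True
    then show ?thesis
      using *[of q "l * b" "l * a"] assms sq by (simp add: algebra_simps)
  next
    case False
    then show ?thesis
      using *[of "1 - q" "l * a" "l * b"] assms sq by (simp add: algebra_simps)
  qed
qed

lemma finite_set_Pi_pmf_bernoulli:
  assumes "finite A"
  shows "finite (set_pmf (Pi_pmf A False (\<lambda>_. bernoulli_pmf q)))"
  using set_Pi_pmf_subset'[OF assms] finite_PiE_dflt[OF assms]
  by (rule finite_subset) simp

text \<open>The exponential moment bound behind McDiarmid's inequality, integrating out one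
  coordinate at a time. The induction must vary \<open>f\<close>, since the averaged function takes
  its place.\<close>

lemma Pi_pmf_bernoulli_mgf:
  fixes f :: "('i \<Rightarrow> bool) \<Rightarrow> real"
  assumes "finite A" "0 \<le> q" "q \<le> 1"
    and "\<And>e y. e \<in> A \<Longrightarrow> \<bar>f (y(e := True)) - f (y(e := False))\<bar> \<le> c e"
  defines "\<nu> \<equiv> \<lambda>A. Pi_pmf A False (\<lambda>_. bernoulli_pmf q)"
  shows "measure_pmf.expectation (\<nu> A) (\<lambda>y. exp (l * f y))
    \<le> exp (l * measure_pmf.expectation (\<nu> A) f + l\<^sup>2 * (\<Sum>e\<in>A. (c e)\<^sup>2) / 8)"
  using assms(1,4)
proof (induction A arbitrary: f rule: finite_induct)
  case empty
  then show ?case by (simp add: \<nu>_def)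
next
  case (insert e A)
  have int: "integrable (measure_pmf (\<nu> A)) k" for k :: "_ \<Rightarrow> real"
    unfolding \<nu>_def by (intro integrable_measure_pmf_finite finite_set_Pi_pmf_bernoulli insert.hyps)
  \<comment> \<open>The conditional expectation of \<open>f\<close> given all coordinates but
    \<open>e\<close>. Averaging keeps the bounds \<open>c\<close> for the remaining coordinates, so
    the induction hypothesis applies to it.\<close>
  define h where "h = (\<lambda>y. q * f (y(e := True)) + (1 - q) * f (y(e := False)))"
  have ex: "measure_pmf.expectation (\<nu> (insert e A)) k = measure_pmf.expectation (\<nu> A)
      (\<lambda>y. q * k (y(e := True)) + (1 - q) * k (y(e := False)))" for k :: "_ \<Rightarrow> real"
  proof -
    have fin: "finite (set_pmf (map_pmf (\<lambda>y. y(e := b)) (\<nu> A)))" for b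
      using finite_set_Pi_pmf_bernoulli[OF insert.hyps(1)] by (simp add: \<nu>_def)
    have "\<nu> (insert e A) = bind_pmf (bernoulli_pmf q) (\<lambda>b. map_pmf (\<lambda>y. y(e := b)) (\<nu> A))"
      unfolding \<nu>_def using insert.hyps by (simp add: Pi_pmf_insert' map_pmf_def)
    then have "measure_pmf.expectation (\<nu> (insert e A)) k
        = (\<Sum>b\<in>UNIV. pmf (bernoulli_pmf q) b *\<^sub>R
            measure_pmf.expectation (map_pmf (\<lambda>y. y(e := b)) (\<nu> A)) k)"
      using fin by (simp add: pmf_expectation_bind[of UNIV])
    then show ?thesis
      using assms(2,3) by (simp add: UNIV_bool int)
  qed
  have "measure_pmf.expectation (\<nu> (insert e A)) (\<lambda>y. exp (l * f y))
      \<le> measure_pmf.expectation (\<nu> A) (\<lambda>y. exp (l * h y) * exp (l\<^sup>2 * (c e)\<^sup>2 / 8))"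
    unfolding ex
  proof (rule integral_mono)
    fix y
    have "q * exp (l * f (y(e := True))) + (1 - q) * exp (l * f (y(e := False)))
        \<le> exp (l * h y + l\<^sup>2 * (f (y(e := True)) - f (y(e := False)))\<^sup>2 / 8)"
      unfolding h_def by (rule bernoulli_mgf) (use assms(2,3) in auto)
    also have "\<dots> \<le> exp (l * h y + l\<^sup>2 * (c e)\<^sup>2 / 8)"
      using mult_left_mono[OF power_mono[OF insert.prems[of e y, OF insertI1] abs_ge_zero, of 2]
          zero_le_power2[of l]]
      by (simp del: fun_upd_apply)
    finally show "q * exp (l * f (y(e := True))) + (1 - q) * exp (l * f (y(e := False)))
        \<le> exp (l * h y) * exp (l\<^sup>2 * (c e)\<^sup>2 / 8)"
      by (simp add: exp_add)
  qed (use int in auto)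
  also have "\<dots> = measure_pmf.expectation (\<nu> A) (\<lambda>y. exp (l * h y)) * exp (l\<^sup>2 * (c e)\<^sup>2 / 8)"
    by simp
  also have "measure_pmf.expectation (\<nu> A) (\<lambda>y. exp (l * h y))
      \<le> exp (l * measure_pmf.expectation (\<nu> A) h + l\<^sup>2 * (\<Sum>e\<in>A. (c e)\<^sup>2) / 8)"
  proof (rule insert.IH)
    fix e' y assume e': "e' \<in> A"
    then have "e' \<noteq> e" using insert.hyps by auto
    then have "h (y(e' := True)) - h (y(e' := False))
        = q * (f ((y(e := True))(e' := True)) - f ((y(e := True))(e' := False)))
          + (1 - q) * (f ((y(e := False))(e' := True)) - f ((y(e := False))(e' := False)))"
      by (simp add: h_def fun_upd_twist algebra_simps)
    also have "\<bar>\<dots>\<bar> \<le> q * c e' + (1 - q) * c e'"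
      using assms(2,3) e' insert.prems
      by (intro order.trans[OF abs_triangle_ineq] add_mono) (auto simp: abs_mult simp del: fun_upd_apply intro!: mult_left_mono)
    finally show "\<bar>h (y(e' := True)) - h (y(e' := False))\<bar> \<le> c e'"
      by (simp add: algebra_simps)
  qed
  finally show ?case
    using insert.hyps by (simp add: ex h_def exp_add ring_distribs add_divide_distrib mult_ac)
qed

lemma Pi_pmf_bernoulli_tail:
  fixes f :: "('i \<Rightarrow> bool) \<Rightarrow> real"
  assumes "finite A" "0 \<le> q" "q \<le> 1"
    and "\<And>e y. e \<in> A \<Longrightarrow> \<bar>f (y(e := True)) - f (y(e := False))\<bar> \<le> c e"
    and S: "(\<Sum>e\<in>A. (c e)\<^sup>2) \<le> S" "S > 0" and "t \<ge> 0"
  defines "\<nu> \<equiv> Pi_pmf A False (\<lambda>_. bernoulli_pmf q)"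
  shows "measure_pmf.prob \<nu> {y. f y > measure_pmf.expectation \<nu> f + t} \<le> exp (- (2 * t\<^sup>2 / S))"
proof -
  \<comment> \<open>The minimiser of \<open>l\<^sup>2 * S / 8 - l * t\<close>, with minimum
    \<open>- (2 * t\<^sup>2 / S)\<close>.\<close>
  define l where "l = 4 * t / S"
  define m where "m = measure_pmf.expectation \<nu> f"
  have fin: "finite (set_pmf \<nu>)"
    using finite_set_Pi_pmf_bernoulli[OF assms(1)] by (simp add: \<nu>_def)
  have l: "l \<ge> 0" using assms by (simp add: l_def)
  have "measure_pmf.prob \<nu> {y. f y > m + t}
      = measure_pmf.expectation \<nu> (indicator {y. f y > m + t})"
    by simp
  also have "\<dots> \<le> measure_pmf.expectation \<nu> (\<lambda>y. exp (l * f y) * exp (- (l * (m + t))))"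
  proof (intro integral_mono integrable_measure_pmf_finite fin)
    fix y
    show "indicator {y. f y > m + t} y \<le> exp (l * f y) * exp (- (l * (m + t)))"
      using l mult_left_mono[of "m + t" "f y" l] by (auto simp: indicator_def simp flip: exp_add)
  qed
  also have "\<dots> = measure_pmf.expectation \<nu> (\<lambda>y. exp (l * f y)) * exp (- (l * (m + t)))"
    by simp
  also have "\<dots> \<le> exp (l * m + l\<^sup>2 * (\<Sum>e\<in>A. (c e)\<^sup>2) / 8) * exp (- (l * (m + t)))"
    unfolding m_def \<nu>_def using assms(1-4) by (intro mult_right_mono Pi_pmf_bernoulli_mgf) auto
  also have "\<dots> \<le> exp (l * m + l\<^sup>2 * S / 8) * exp (- (l * (m + t)))"
    using S by (simp add: mult_left_mono)
  also have "\<dots> = exp (- (2 * t\<^sup>2 / S))"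
    using S by (simp add: l_def power2_eq_square field_simps flip: exp_add)
  finally show ?thesis by (simp add: m_def)
qed

section \<open>Counting embeddings\<close>

definition injections :: "'a set \<Rightarrow> 'b set \<Rightarrow> ('a \<Rightarrow> 'b) set" where
  "injections V B = {\<psi> \<in> V \<rightarrow>\<^sub>E B. inj_on \<psi> V}"

lemma finite_injections: "finite V \<Longrightarrow> finite B \<Longrightarrow> finite (injections V B)"
  by (simp add: injections_def finite_PiE)

lemma card_injections:
  assumes "finite V" "finite B"
  shows "card (injections V B) = (\<Prod>i<card V. card B - i)"
  using card_inj_on_subset_funcset[OF assms, of V] by (simp add: injections_def atLeast0LessThan)

lemma card_injections_le:
  assumes "finite V" "finite B"
  shows "card (injections V B) \<le> card B ^ card V"
proof -
  have "(\<Prod>i<card V. card B - i) \<le> (\<Prod>i<card V. card B)"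
    by (intro prod_mono) auto
  then show ?thesis by (simp add: card_injections assms)
qed

lemma card_injections_ge:
  assumes "finite V" "finite B"
  shows "(card B - card V) ^ card V \<le> card (injections V B)"
proof -
  have "(\<Prod>i<card V. card B - card V) \<le> (\<Prod>i<card V. card B - i)"
    by (intro prod_mono) auto
  then show ?thesis by (simp add: card_injections assms)
qed

text \<open>Erasing the value at \<open>a\<close>, that is, resetting it to the extensional default
  \<open>undefined\<close>, is a bijection. The predicate \<open>P\<close> lets the lemma be
  iterated to prescribe further values.\<close>

lemma card_injections_fixed:
  assumes "a \<in> V" "u \<in> B"
  shows "card {\<psi> \<in> injections V B. \<psi> a = u \<and> P \<psi>}
    = card {\<phi> \<in> injections (V - {a}) (B - {u}). P (\<phi>(a := u))}"
proof (rule bij_betw_same_card)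
  have ext: "\<psi>(a := undefined) = restrict \<psi> (V - {a})" if "\<psi> \<in> injections V B" for \<psi>
    using that by (auto simp: injections_def PiE_def extensional_def fun_eq_iff)
  show "bij_betw (\<lambda>\<psi>. \<psi>(a := undefined)) {\<psi> \<in> injections V B. \<psi> a = u \<and> P \<psi>}
    {\<phi> \<in> injections (V - {a}) (B - {u}). P (\<phi>(a := u))}"
  proof (rule bij_betwI[where g = "\<lambda>\<phi>. \<phi>(a := u)"])
    show "(\<lambda>\<psi>. \<psi>(a := undefined)) \<in> {\<psi> \<in> injections V B. \<psi> a = u \<and> P \<psi>}
      \<rightarrow> {\<phi> \<in> injections (V - {a}) (B - {u}). P (\<phi>(a := u))}"
    proof
      fix \<psi> assume \<psi>: "\<psi> \<in> {\<psi> \<in> injections V B. \<psi> a = u \<and> P \<psi>}"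
      then have inj: "inj_on \<psi> V" and maps: "\<And>v. v \<in> V \<Longrightarrow> \<psi> v \<in> B" and u: "\<psi> a = u"
        by (auto simp: injections_def)
      have "restrict \<psi> (V - {a}) \<in> injections (V - {a}) (B - {u})"
        using inj maps u assms(1)
        by (auto simp: injections_def inj_on_def)
      then have "\<psi>(a := undefined) \<in> injections (V - {a}) (B - {u})"
        using \<psi> by (simp only: ext mem_Collect_eq)
      moreover have "\<psi>(a := undefined, a := u) = \<psi>"
        using u by auto
      then have "P (\<psi>(a := undefined, a := u))"
        using \<psi> by (simp only: mem_Collect_eq)
      ultimately show "\<psi>(a := undefined) \<in> {\<phi> \<in> injections (V - {a}) (B - {u}). P (\<phi>(a := u))}"
        by blast
    qed
    show "(\<lambda>\<phi>. \<phi>(a := u)) \<in> {\<phi> \<in> injections (V - {a}) (B - {u}). P (\<phi>(a := u))}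
      \<rightarrow> {\<psi> \<in> injections V B. \<psi> a = u \<and> P \<psi>}"
    proof
      fix \<phi> assume \<phi>: "\<phi> \<in> {\<phi> \<in> injections (V - {a}) (B - {u}). P (\<phi>(a := u))}"
      then have "\<phi> \<in> (V - {a}) \<rightarrow>\<^sub>E (B - {u})" "inj_on \<phi> (V - {a})"
        by (auto simp: injections_def)
      then have "inj_on (\<phi>(a := u)) V"
        by (auto simp: inj_on_def PiE_iff)
      moreover have "\<phi>(a := u) \<in> V \<rightarrow>\<^sub>E B"
        using \<open>\<phi> \<in> (V - {a}) \<rightarrow>\<^sub>E (B - {u})\<close> assms
        by (auto simp: PiE_iff extensional_def)
      ultimately show "\<phi>(a := u) \<in> {\<psi> \<in> injections V B. \<psi> a = u \<and> P \<psi>}"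
        using \<phi> by (simp add: injections_def)
    qed
  next
    fix \<phi> assume "\<phi> \<in> {\<phi> \<in> injections (V - {a}) (B - {u}). P (\<phi>(a := u))}"
    then have "\<phi> a = undefined"
      by (auto simp: injections_def PiE_def extensional_def)
    then show "(\<phi>(a := u))(a := undefined) = \<phi>"
      by (simp add: fun_upd_idem)
  qed auto
qed

lemma card_injections_fixed2:
  assumes "a \<in> V" "b \<in> V" "a \<noteq> b" "u \<in> B" "v \<in> B" "u \<noteq> v"
  shows "card {\<psi> \<in> injections V B. \<psi> a = u \<and> \<psi> b = v} = card (injections (V - {a, b}) (B - {u, v}))"
proof -
  have "card {\<psi> \<in> injections V B. \<psi> a = u \<and> \<psi> b = v}
      = card {\<psi> \<in> injections (V - {a}) (B - {u}). \<psi> b = v \<and> True}"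
    using assms by (subst card_injections_fixed) auto
  also have "\<dots> = card (injections (V - {a} - {b}) (B - {u} - {v}))"
    using assms by (subst card_injections_fixed) auto
  also have "V - {a} - {b} = V - {a, b}" by auto
  also have "B - {u} - {v} = B - {u, v}" by auto
  finally show ?thesis .
qed

text \<open>Three prescribed values leave \<open>card V - 3\<close> free vertices. Multiplying by
  \<open>card B\<close> keeps the exponent at \<open>card V - 2\<close>, as in the Hamiltonian. If
  \<open>a\<close>, \<open>b\<close>, \<open>c\<close> are not distinct the set is empty; otherwise
  \<open>card V\<close> is at least 3 and the truncated subtractions are exact.\<close>

lemma card_injections_fixed3:
  assumes "finite V" "finite B" "u \<in> B" "v \<in> B" "w \<in> B" "u \<noteq> v" "u \<noteq> w" "v \<noteq> w"
    and "a \<in> V" "b \<in> V" "c \<in> V"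
  shows "card {\<psi> \<in> injections V B. \<psi> a = u \<and> \<psi> b = v \<and> \<psi> c = w} * card B \<le> card B ^ (card V - 2)"
proof (cases "a \<noteq> b \<and> a \<noteq> c \<and> b \<noteq> c")
  case True
  have "card {\<psi> \<in> injections V B. \<psi> a = u \<and> \<psi> b = v \<and> \<psi> c = w}
      = card {\<psi> \<in> injections (V - {a}) (B - {u}). \<psi> b = v \<and> \<psi> c = w}"
    using assms True by (subst card_injections_fixed) auto
  also have "\<dots> = card (injections (V - {a} - {b, c}) (B - {u} - {v, w}))"
    using assms True by (subst card_injections_fixed2) auto
  also have "\<dots> \<le> card (B - {u} - {v, w}) ^ card (V - {a} - {b, c})"
    using assms by (intro card_injections_le) auto
  also have "\<dots> \<le> card B ^ card (V - {a} - {b, c})"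
    using assms by (intro power_mono card_mono) auto
  finally have *: "card {\<psi> \<in> injections V B. \<psi> a = u \<and> \<psi> b = v \<and> \<psi> c = w}
      \<le> card B ^ card (V - {a} - {b, c})" .
  have "card {a, b, c} \<le> card V"
    using assms by (intro card_mono) auto
  moreover have "card (V - {a} - {b, c}) = card V - 3"
    using assms True by (simp add: Diff_insert2[symmetric] card_Diff_subset)
  ultimately have "card V - 2 = Suc (card (V - {a} - {b, c}))"
    using True by simp
  then show ?thesis using * by (simp add: mult.commute)
next
  case False
  then have "{\<psi> \<in> injections V B. \<psi> a = u \<and> \<psi> b = v \<and> \<psi> c = w} = {}"
    using assms by auto
  then show ?thesis by (simp only: card.empty)
qed

section \<open>Embeddings that cover a given edge of the complete graph\<close>

definition copies_through :: "nat \<Rightarrow> 'v graph \<Rightarrow> nat set \<Rightarrow> ('v \<Rightarrow> nat) set" where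
  "copies_through n G e = {\<psi> \<in> injections (vertices G) {1..n}. e \<in> (`) \<psi> ` edges G}"

context
  fixes G :: "'v graph"
  assumes G: "finite_simple_graph G"
begin

lemma finite_vertices: "finite (vertices G)"
  using G by (simp add: finite_simple_graph_def)

lemma edge_in_nsets: "g \<in> edges G \<Longrightarrow> g \<in> nsets (vertices G) 2"
  using G by (auto simp: finite_simple_graph_def)

lemma edge_subset: "g \<in> edges G \<Longrightarrow> g \<subseteq> vertices G"
  using edge_in_nsets[of g] by (auto simp: nsets_def)

lemma finite_edges: "finite (edges G)"
  using finite_subset[OF _ finite_imp_finite_nsets[OF finite_vertices, of 2]] G
  by (simp add: finite_simple_graph_def)

lemma finite_copies_through: "finite (copies_through n G e)"
  using finite_injections[OF finite_vertices, of "{1..n}"] by (simp add: copies_through_def)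

lemma inj_on_image_edges:
  assumes "\<psi> \<in> injections (vertices G) B"
  shows "inj_on ((`) \<psi>) (edges G)"
proof (rule inj_onI)
  fix g h assume "g \<in> edges G" "h \<in> edges G" "\<psi> ` g = \<psi> ` h"
  then show "g = h"
    using assms edge_subset inj_on_image_eq_iff[of \<psi> "vertices G" g h] by (simp add: injections_def)
qed

lemma image_edge_in_complete_edges:
  assumes "\<psi> \<in> injections (vertices G) {1..n}" "g \<in> edges G"
  shows "\<psi> ` g \<in> complete_edges n"
proof -
  have "inj_on \<psi> g" "\<psi> ` g \<subseteq> {1..n}"
    using assms edge_subset[OF assms(2)] by (auto simp: injections_def intro: inj_on_subset)
  then show ?thesis
    using edge_in_nsets[OF assms(2)] by (auto simp: complete_edges_def nsets_def card_image)
qed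

text \<open>Exactly one edge of \<open>G\<close> is mapped to \<open>e\<close>; it can be laid on
  \<open>e\<close> in two directions, and \<open>m\<close> counts the placements of the other
  vertices. The bounds on \<open>m\<close> are stated only when an edge exists, since they rest on
  \<open>G\<close> having two vertices.\<close>

lemma card_copies_through:
  assumes e: "e \<in> complete_edges n"
  shows "\<exists>m. card (copies_through n G e) = card (edges G) * (2 * m) \<and>
    (edges G \<noteq> {} \<longrightarrow> (n - card (vertices G)) ^ (card (vertices G) - 2) \<le> m \<and>
       m \<le> n ^ (card (vertices G) - 2))"
proof -
  let ?V = "vertices G" and ?B = "{1..n}"
  obtain u v where uv: "e = {u, v}" "u \<noteq> v" "u \<in> ?B" "v \<in> ?B"
    using e unfolding complete_edges_def by (elim nsets2_E) auto
  define m where "m = (\<Prod>i<card ?V - 2. (n - 2) - i)"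
  have card_edge: "card {\<psi> \<in> injections ?V ?B. \<psi> ` g = e} = 2 * m"
    and bounds: "(n - card ?V) ^ (card ?V - 2) \<le> m \<and> m \<le> n ^ (card ?V - 2)"
    if g: "g \<in> edges G" for g
  proof -
    obtain a b where ab: "g = {a, b}" "a \<noteq> b" "a \<in> ?V" "b \<in> ?V"
      using edge_in_nsets[OF g] by (elim nsets2_E) auto
    have cards: "card (?V - {a, b}) = card ?V - 2" "card (?B - {u, v}) = n - 2"
      using ab uv finite_vertices by (simp_all add: card_Diff_subset)
    then have m: "card (injections (?V - {a, b}) (?B - {u, v})) = m"
      using finite_vertices by (subst card_injections) (simp_all add: m_def)
    define S where "S = (\<lambda>u v. {\<psi> \<in> injections ?V ?B. \<psi> a = u \<and> \<psi> b = v})"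
    have "{\<psi> \<in> injections ?V ?B. \<psi> ` g = e} = S u v \<union> S v u"
      using ab uv by (auto simp: S_def doubleton_eq_iff)
    moreover have "card (S u v \<union> S v u) = card (S u v) + card (S v u)"
      using uv finite_injections[OF finite_vertices, of ?B]
      by (intro card_Un_disjoint) (auto simp: S_def)
    moreover have "card (S u v) = m"
      using card_injections_fixed2[OF ab(3,4,2) uv(3,4,2)] m by (simp add: S_def)
    moreover have "card (S v u) = m"
      using card_injections_fixed2[OF ab(3,4,2) uv(4,3) uv(2)[symmetric]] m
      by (simp add: S_def insert_commute)
    ultimately show "card {\<psi> \<in> injections ?V ?B. \<psi> ` g = e} = 2 * m"
      by simp
    \<comment> \<open>Needed for the next identity, which is false for truncated subtraction when
      \<open>card ?V < 2 < n\<close>.\<close>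
    have "2 \<le> card ?V"
      using card_mono[of ?V "{a, b}"] ab finite_vertices by simp
    then have "n - card ?V = (n - 2) - (card ?V - 2)" by simp
    then have "(n - card ?V) ^ (card ?V - 2) \<le> m"
      using card_injections_ge[of "?V - {a, b}" "?B - {u, v}"] finite_vertices
      by (simp only: cards m finite_Diff finite_atLeastAtMost)
    moreover have "m \<le> (n - 2) ^ (card ?V - 2)"
      using card_injections_le[of "?V - {a, b}" "?B - {u, v}"] finite_vertices
      by (simp only: cards m finite_Diff finite_atLeastAtMost)
    then have "m \<le> n ^ (card ?V - 2)"
      by (rule order.trans) (simp add: power_mono)
    ultimately show "(n - card ?V) ^ (card ?V - 2) \<le> m \<and> m \<le> n ^ (card ?V - 2)" ..
  qed
  have "copies_through n G e = (\<Union>g\<in>edges G. {\<psi> \<in> injections ?V ?B. \<psi> ` g = e})"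
    by (auto simp: copies_through_def)
  also have "card \<dots> = (\<Sum>g\<in>edges G. card {\<psi> \<in> injections ?V ?B. \<psi> ` g = e})"
  proof (rule card_UN_disjoint)
    show "\<forall>g\<in>edges G. \<forall>h\<in>edges G. g \<noteq> h \<longrightarrow>
        {\<psi> \<in> injections ?V ?B. \<psi> ` g = e} \<inter> {\<psi> \<in> injections ?V ?B. \<psi> ` h = e} = {}"
    proof (intro ballI impI)
      fix g h assume gh: "g \<in> edges G" "h \<in> edges G" "g \<noteq> h"
      have "\<psi> ` g = e \<Longrightarrow> \<psi> ` h \<noteq> e" if "\<psi> \<in> injections ?V ?B" for \<psi>
        using inj_on_eq_iff[OF inj_on_image_edges[OF that] gh(1,2)] gh(3) by simp
      then show "{\<psi> \<in> injections ?V ?B. \<psi> ` g = e} \<inter> {\<psi> \<in> injections ?V ?B. \<psi> ` h = e} = {}"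
        by auto
    qed
  qed (simp_all add: finite_edges finite_injections finite_vertices)
  also have "\<dots> = card (edges G) * (2 * m)"
    using card_edge by simp
  finally show ?thesis
    using bounds by (intro exI[of _ m] conjI impI) (auto simp: ex_in_conv[symmetric])
qed

lemma card_copies_through_le:
  assumes "e \<in> complete_edges n"
  shows "card (copies_through n G e) \<le> 2 * card (edges G) * n ^ (card (vertices G) - 2)"
proof -
  obtain m where "card (copies_through n G e) = card (edges G) * (2 * m)"
    and "edges G \<noteq> {} \<Longrightarrow> m \<le> n ^ (card (vertices G) - 2)"
    using card_copies_through[OF assms] by blast
  then show ?thesis by (cases "edges G = {}") simp_all
qed

lemma card_copies_through_ge:
  assumes "e \<in> complete_edges n"
  shows "2 * card (edges G) * (n - card (vertices G)) ^ (card (vertices G) - 2)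
    \<le> card (copies_through n G e)"
proof -
  obtain m where "card (copies_through n G e) = card (edges G) * (2 * m)"
    and "edges G \<noteq> {} \<Longrightarrow> (n - card (vertices G)) ^ (card (vertices G) - 2) \<le> m"
    using card_copies_through[OF assms] by blast
  then show ?thesis by (cases "edges G = {}") simp_all
qed

text \<open>Double counting: each embedding through \<open>e\<close> covers exactly
  \<open>card (edges G)\<close> edges of the complete graph.\<close>

lemma sum_card_copies_through_Int:
  "(\<Sum>f\<in>complete_edges n. card (copies_through n G e \<inter> copies_through n G f))
    = card (edges G) * card (copies_through n G e)"
proof -
  have Int: "card (copies_through n G e \<inter> copies_through n G f)
      = (\<Sum>\<psi>\<in>copies_through n G e. of_bool (\<psi> \<in> copies_through n G f))" for f
    using finite_copies_through by (simp add: of_bool_def sum.If_cases Int_def)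
  have "(\<Sum>f\<in>complete_edges n. of_bool (\<psi> \<in> copies_through n G f)) = card (edges G)"
    if "\<psi> \<in> copies_through n G e" for \<psi>
  proof -
    have \<psi>: "\<psi> \<in> injections (vertices G) {1..n}"
      using that by (simp add: copies_through_def)
    then have "{f \<in> complete_edges n. \<psi> \<in> copies_through n G f} = (`) \<psi> ` edges G"
      using image_edge_in_complete_edges by (auto simp: copies_through_def)
    then show ?thesis
      using card_image[OF inj_on_image_edges[OF \<psi>]]
      by (simp add: of_bool_def sum.If_cases Int_def)
  qed
  then show ?thesis
    unfolding Int by (subst sum.swap) (simp add: mult.commute)
qed

text \<open>
  Two distinct edges span at least three vertices, so an embedding covering both has at most
  $|V| - 3$ free vertices.
\<close>

lemma card_copies_through_Int_le:
  assumes e: "e \<in> complete_edges n" and f: "f \<in> complete_edges n" and "e \<noteq> f"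
  shows "card (copies_through n G e \<inter> copies_through n G f) * n
    \<le> card (vertices G) ^ 3 * n ^ (card (vertices G) - 2)"
proof -
  let ?V = "vertices G" and ?B = "{1..n}"
  obtain u v where uv: "e = {u, v}" "u \<noteq> v" "u \<in> ?B" "v \<in> ?B"
    using e unfolding complete_edges_def by (elim nsets2_E) auto
  have "\<not> f \<subseteq> e"
    using e f \<open>e \<noteq> f\<close> card_subset_eq[of e f] by (auto simp: complete_edges_def nsets_def)
  then obtain w where w: "w \<in> f" "w \<noteq> u" "w \<noteq> v"
    using uv by auto
  then have "w \<in> ?B" using f by (auto simp: complete_edges_def nsets_def)
  \<comment> \<open>A union bound over the possible preimages of \<open>u\<close>, \<open>v\<close>,
    \<open>w\<close> produces the factor \<open>card ?V ^ 3\<close>.\<close>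
  define S where "S = (\<lambda>(a, b, c). {\<psi> \<in> injections ?V ?B. \<psi> a = u \<and> \<psi> b = v \<and> \<psi> c = w})"
  have "copies_through n G e \<inter> copies_through n G f \<subseteq> \<Union> (S ` (?V \<times> ?V \<times> ?V))"
  proof
    fix \<psi> assume "\<psi> \<in> copies_through n G e \<inter> copies_through n G f"
    then obtain g h where \<psi>: "\<psi> \<in> injections ?V ?B" and "g \<in> edges G" "h \<in> edges G"
      and gh: "e = \<psi> ` g" "f = \<psi> ` h"
      by (auto simp: copies_through_def)
    then have "g \<subseteq> ?V" "h \<subseteq> ?V" using edge_subset by auto
    moreover obtain a b c where "a \<in> g" "b \<in> g" "c \<in> h" "\<psi> a = u" "\<psi> b = v" "\<psi> c = w"
      using gh uv w by (smt (verit) image_iff insertI1 insertI2)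
    ultimately have "(a, b, c) \<in> ?V \<times> ?V \<times> ?V" "\<psi> \<in> S (a, b, c)"
      using \<psi> by (auto simp: S_def)
    then show "\<psi> \<in> \<Union> (S ` (?V \<times> ?V \<times> ?V))" by blast
  qed
  then have "card (copies_through n G e \<inter> copies_through n G f) \<le> card (\<Union> (S ` (?V \<times> ?V \<times> ?V)))"
    using finite_vertices finite_injections[OF finite_vertices, of ?B]
    by (intro card_mono finite_UN_I) (auto simp: S_def)
  also have "\<dots> \<le> (\<Sum>z\<in>?V \<times> ?V \<times> ?V. card (S z))"
    using finite_vertices by (intro card_UN_le) auto
  finally have "card (copies_through n G e \<inter> copies_through n G f) * n
      \<le> (\<Sum>z\<in>?V \<times> ?V \<times> ?V. card (S z) * n)"
    unfolding sum_distrib_right[symmetric] by (rule mult_right_mono) simp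
  also have "\<dots> \<le> (\<Sum>z\<in>?V \<times> ?V \<times> ?V. n ^ (card ?V - 2))"
    using card_injections_fixed3[OF finite_vertices, of ?B u v w] uv w \<open>w \<in> ?B\<close>
    by (intro sum_mono) (auto simp: S_def)
  also have "\<dots> = card ?V ^ 3 * n ^ (card ?V - 2)"
    by (simp add: card_cartesian_product power3_eq_cube)
  finally show ?thesis .
qed

lemma inj_hom_count_eq:
  "inj_hom_count n G x = real (card {\<psi> \<in> injections (vertices G) {1..n}. \<forall>f\<in>(`) \<psi> ` edges G. x f})"
proof -
  have prod: "(\<Prod>a\<in>A. of_bool (P a) :: real) = of_bool (\<forall>a\<in>A. P a)" if "finite A" for A and P :: "'v set \<Rightarrow> bool"
    using that by (induction A rule: finite_induct) auto
  have "inj_hom_count n G x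
      = (\<Sum>\<psi>\<in>injections (vertices G) {1..n}. of_bool (\<forall>f\<in>(`) \<psi> ` edges G. x f))"
    using finite_edges by (simp add: inj_hom_count_def injections_def prod)
  also have "\<dots> = real (card {\<psi> \<in> injections (vertices G) {1..n}. \<forall>f\<in>(`) \<psi> ` edges G. x f})"
    using finite_injections[OF finite_vertices, of "{1..n}"]
    by (simp add: of_bool_def sum.If_cases Int_def)
  finally show ?thesis .
qed

text \<open>Copies avoiding \<open>e\<close> cancel; with \<open>e\<close> absent no copy through it
  counts, and with \<open>e\<close> present only its other edges are still required.\<close>

lemma inj_hom_count_diff:
  "inj_hom_count n G (x(e := True)) - inj_hom_count n G (x(e := False))
    = real (card {\<psi> \<in> copies_through n G e. \<forall>f\<in>(`) \<psi> ` edges G - {e}. x f})"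
proof -
  let ?I = "injections (vertices G) {1..n}"
  have "{\<psi> \<in> ?I. \<forall>f\<in>(`) \<psi> ` edges G. (x(e := True)) f}
      = {\<psi> \<in> ?I. \<forall>f\<in>(`) \<psi> ` edges G. (x(e := False)) f}
        \<union> {\<psi> \<in> copies_through n G e. \<forall>f\<in>(`) \<psi> ` edges G - {e}. x f}"
    by (auto simp: copies_through_def)
  moreover have "card \<dots> = card {\<psi> \<in> ?I. \<forall>f\<in>(`) \<psi> ` edges G. (x(e := False)) f}
      + card {\<psi> \<in> copies_through n G e. \<forall>f\<in>(`) \<psi> ` edges G - {e}. x f}"
    using finite_injections[OF finite_vertices, of "{1..n}"] finite_copies_through
    by (intro card_Un_disjoint) (auto simp: copies_through_def)
  ultimately show ?thesis by (simp only: inj_hom_count_eq)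
qed

end

section \<open>The local field of the ERGM\<close>

text \<open>The discrete derivative of the Hamiltonian at \<open>e\<close>. Removing
  \<open>e\<close> from the required edges makes it independent of \<open>x e\<close>; it is the
  log-odds of \<open>e\<close> given the other edges, so its \<open>logistic\<close> is the
  heat-bath rate.\<close>

definition local_field ::
    "nat \<Rightarrow> (nat \<Rightarrow> 'v graph) \<Rightarrow> (nat \<Rightarrow> real) \<Rightarrow> nat \<Rightarrow> nat set \<Rightarrow> config \<Rightarrow> real" where
  "local_field s G \<beta> n e x =
    (\<Sum>i=1..s. \<beta> i / real n powi (int (card (vertices (G i))) - 2)
       * real (card {\<psi> \<in> copies_through n (G i) e. \<forall>f\<in>(`) \<psi> ` edges (G i) - {e}. x f}))"

section \<open>The logistic function and expectations in the product measure\<close>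

lemma logistic_pos: "0 < logistic u" and logistic_less_1: "logistic u < 1"
  by (simp_all add: logistic_def add_pos_pos)

lemma logistic_has_derivative:
  "(logistic has_real_derivative logistic u * (1 - logistic u)) (at u)"
proof -
  have "1 + exp u \<noteq> 0" by (metis add_pos_pos exp_gt_zero less_numeral_extra(1,3))
  then show ?thesis
    unfolding logistic_def
    by (auto intro!: derivative_eq_intros simp: divide_simps) (simp add: algebra_simps power2_eq_square)
qed

text \<open>The derivative \<open>logistic u * (1 - logistic u)\<close> lies in [0,1]. The crude
  Lipschitz constant 1 is enough: it only converts tolerances in the field into tolerances in
  \<open>q\<close>, while the contraction rate comes from \<open>ergm_phi\<close> as a
  whole.\<close>

lemma logistic_diff_le:
  assumes "u \<le> v"
  shows "0 \<le> logistic v - logistic u" "logistic v - logistic u \<le> v - u"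
proof -
  have nonneg: "0 \<le> logistic z * (1 - logistic z)" for z
    using logistic_pos[of z] logistic_less_1[of z] by simp
  have le: "logistic z * (1 - logistic z) \<le> 1" for z
    using logistic_pos[of z] logistic_less_1[of z] by (simp add: mult_le_one)
  have "logistic u \<le> logistic v"
    by (rule DERIV_nonneg_imp_nondecreasing[OF assms])
       (rule exI, rule conjI, rule logistic_has_derivative, rule nonneg)
  then show "0 \<le> logistic v - logistic u" by simp
  have "(\<lambda>z. z - logistic z) u \<le> (\<lambda>z. z - logistic z) v"
  proof (rule DERIV_nonneg_imp_nondecreasing[OF assms])
    fix z
    have "((\<lambda>z. z - logistic z) has_real_derivative 1 - logistic z * (1 - logistic z)) (at z)"
      by (intro derivative_intros logistic_has_derivative)
    then show "\<exists>y. ((\<lambda>z. z - logistic z) has_real_derivative y) (at z) \<and> 0 \<le> y"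
      using le[of z] by (intro exI conjI) auto
  qed
  then show "logistic v - logistic u \<le> v - u" by simp
qed

text \<open>With factor 1 outside \<open>S\<close> the indicator becomes a product over all
  coordinates, and independence applies.\<close>

lemma expectation_erdos_renyi_subset:
  assumes "0 \<le> q" "q \<le> 1" "S \<subseteq> complete_edges n"
  shows "measure_pmf.expectation (erdos_renyi n q) (\<lambda>y. of_bool (\<forall>f\<in>S. y f)) = q ^ card S"
proof -
  have fin: "finite S" using assms(3) finite_subset by blast
  have "(\<Prod>f\<in>complete_edges n. if f \<in> S then of_bool (y f) else 1) = (of_bool (\<forall>f\<in>S. y f) :: real)"
    for y
  proof (cases "\<forall>f\<in>S. y f")
    case True
    then show ?thesis by (auto intro!: prod.neutral)
  next
    case False
    then show ?thesis using assms(3) by (auto intro!: prod_zero)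
  qed
  then have "measure_pmf.expectation (erdos_renyi n q) (\<lambda>y. of_bool (\<forall>f\<in>S. y f) :: real)
      = measure_pmf.expectation (erdos_renyi n q)
          (\<lambda>y. \<Prod>f\<in>complete_edges n. if f \<in> S then of_bool (y f) else 1)"
    by (simp only:)
  also have "\<dots> = (\<Prod>f\<in>complete_edges n.
      measure_pmf.expectation (bernoulli_pmf q) (\<lambda>b. if f \<in> S then of_bool b else 1))"
    unfolding erdos_renyi_def
    by (rule expectation_prod_Pi_pmf) (auto intro!: integrable_measure_pmf_finite)
  also have "\<dots> = (\<Prod>f\<in>complete_edges n. if f \<in> S then q else 1)"
    using assms by (intro prod.cong) auto
  also have "\<dots> = q ^ card S"
    using assms(3) by (simp add: prod.If_cases Int_absorb1)
  finally show ?thesis .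
qed

lemma finite_set_pmf_erdos_renyi: "finite (set_pmf (erdos_renyi n q))"
  using set_pmf_erdos_renyi finite_configs by (rule finite_subset)

lemma finite_set_pmf_ergm: "finite (set_pmf (ergm s G \<beta> n))"
  by (simp add: set_pmf_ergm)

lemma erdos_renyi_heat_bath:
  assumes "0 \<le> q" "q \<le> 1" and e: "e \<in> complete_edges n"
  shows "bind_pmf (erdos_renyi n q) (heat_bath (\<lambda>_. q) e) = erdos_renyi n q"
proof (rule heat_bath_invariant)
  fix x
  have "pmf (erdos_renyi n q) (x(e := b)) = pmf (bernoulli_pmf q) b *
      (if \<forall>f. f \<notin> complete_edges n \<longrightarrow> f \<noteq> e \<longrightarrow> x f = False
       then \<Prod>f\<in>complete_edges n - {e}. pmf (bernoulli_pmf q) (x f) else 0)" for b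
    using e unfolding erdos_renyi_def
    by (subst pmf_Pi) (auto simp: prod.remove[OF _ e] intro!: prod.cong)
  then show "pmf (erdos_renyi n q) (x(e := True)) * (1 - q) = pmf (erdos_renyi n q) (x(e := False)) * q"
    using assms by simp
qed (use assms in auto)

section \<open>The local field of a fixed model: monotonicity, stationarity, mean and
  concentration\<close>

locale ergm_model =
  fixes s :: nat and G :: "nat \<Rightarrow> 'v graph" and \<beta> :: "nat \<Rightarrow> real"
  assumes simple: "i \<in> {1..s} \<Longrightarrow> finite_simple_graph (G i)"
    and \<beta>_pos: "i \<in> {1..s} \<Longrightarrow> \<beta> i > 0"
begin

abbreviation "nv i \<equiv> card (vertices (G i))"
abbreviation "ne i \<equiv> card (edges (G i))"
abbreviation "field \<equiv> local_field s G \<beta>"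
abbreviation "\<pi> \<equiv> ergm s G \<beta>"
abbreviation "\<Psi> \<equiv> ergm_Psi s G \<beta>"

definition weight :: "nat \<Rightarrow> nat \<Rightarrow> real" where
  "weight n i = \<beta> i / real n powi (int (nv i) - 2)"

lemma \<beta>_nonneg: "i \<in> {1..s} \<Longrightarrow> 0 \<le> \<beta> i"
  using \<beta>_pos[of i] by simp

lemma weight_nonneg: "i \<in> {1..s} \<Longrightarrow> 0 \<le> weight n i"
  using \<beta>_nonneg[of i] by (simp add: weight_def)

lemma field_altdef:
  "field n e x = (\<Sum>i=1..s. weight n i
     * real (card {\<psi> \<in> copies_through n (G i) e. \<forall>f\<in>(`) \<psi> ` edges (G i) - {e}. x f}))"
  by (simp add: local_field_def weight_def)

text \<open>An edge forces at least two vertices, so the integer exponent \<open>nv i - 2\<close>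
  agrees with the truncated one and the normalisation cancels the order of the copy count. Edgeless
  graphs are treated apart throughout, via \<open>copies_through_no_edges\<close>.\<close>

lemma weight_mult_power:
  assumes "i \<in> {1..s}" "edges (G i) \<noteq> {}" "n \<ge> 1"
  shows "weight n i * real n ^ (nv i - 2) = \<beta> i"
proof -
  obtain g where "g \<in> edges (G i)" using assms(2) by blast
  then have "g \<subseteq> vertices (G i)" "card g = 2"
    using edge_in_nsets[OF simple[OF assms(1)]] by (auto simp: nsets_def)
  then have "2 \<le> nv i"
    using card_mono[OF finite_vertices[OF simple[OF assms(1)]], of g] by simp
  then have exponent: "int (nv i) - 2 = int (nv i - 2)" by simp
  show ?thesis
    using assms(3) unfolding weight_def exponent power_int_of_nat by simp
qed

lemma copies_through_no_edges: "edges (G i) = {} \<Longrightarrow> copies_through n (G i) e = {}"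
  by (simp add: copies_through_def)

lemma hamiltonian_diff:
  "hamiltonian s G \<beta> n (x(e := True)) - hamiltonian s G \<beta> n (x(e := False)) = field n e x"
proof -
  have "hamiltonian s G \<beta> n (x(e := True)) - hamiltonian s G \<beta> n (x(e := False))
      = (\<Sum>i=1..s. weight n i *
          (inj_hom_count n (G i) (x(e := True)) - inj_hom_count n (G i) (x(e := False))))"
    unfolding hamiltonian_def weight_def sum_subtractf[symmetric]
    by (intro sum.cong) (simp_all add: diff_divide_distrib right_diff_distrib)
  also have "\<dots> = field n e x"
    unfolding field_altdef by (intro sum.cong arg_cong2[of _ _ _ _ "(*)"] inj_hom_count_diff simple) auto
  finally show ?thesis .
qed

lemma field_upd_same: "field n e (x(e := b)) = field n e x"
proof -
  have "(\<forall>f\<in>A - {e}. (x(e := b)) f) \<longleftrightarrow> (\<forall>f\<in>A - {e}. x f)" for A by auto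
  then show ?thesis unfolding field_altdef by (simp only:)
qed

text \<open>The weights are nonnegative because \<beta> is positive, and more edges complete more
  copies. Comparing \<open>x\<close> and \<open>y\<close> on \<open>complete_edges n\<close>
  suffices since copies use no other edges.\<close>

lemma field_mono:
  assumes "\<And>f. f \<in> complete_edges n \<Longrightarrow> x f \<Longrightarrow> y f"
  shows "field n e x \<le> field n e y"
  unfolding field_altdef
proof (intro sum_mono mult_left_mono weight_nonneg of_nat_mono card_mono)
  fix i assume i: "i \<in> {1..s}"
  show "finite {\<psi> \<in> copies_through n (G i) e. \<forall>f\<in>(`) \<psi> ` edges (G i) - {e}. y f}"
    using finite_copies_through[OF simple[OF i]] by simp
  have "y f" if "\<psi> \<in> copies_through n (G i) e" "f \<in> (`) \<psi> ` edges (G i)" "x f" for \<psi> f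
    using image_edge_in_complete_edges[OF simple[OF i], of \<psi> n] that assms[of f]
    by (auto simp: copies_through_def)
  then show "{\<psi> \<in> copies_through n (G i) e. \<forall>f\<in>(`) \<psi> ` edges (G i) - {e}. x f}
      \<subseteq> {\<psi> \<in> copies_through n (G i) e. \<forall>f\<in>(`) \<psi> ` edges (G i) - {e}. y f}"
    by blast
qed

text \<open>Switching \<open>e\<close> on multiplies the Gibbs weight by
  \<open>exp (field n e x)\<close>, which is also the odds of \<open>logistic (field n e x)\<close>;
  the partition function cancels.\<close>

lemma ergm_heat_bath:
  assumes e: "e \<in> complete_edges n"
  shows "bind_pmf (\<pi> n) (heat_bath (\<lambda>x. logistic (field n e x)) e) = \<pi> n"
proof (rule heat_bath_invariant)
  fix x
  have mem: "x(e := b) \<in> configs n \<longleftrightarrow> x(e := False) \<in> configs n" for b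
    using e by (auto simp: configs_def PiE_dflt_def)
  define h where "h = hamiltonian s G \<beta> n (x(e := False))"
  have h: "hamiltonian s G \<beta> n (x(e := True)) = h + field n e x"
    using hamiltonian_diff[of n x e] by (simp add: h_def)
  have "1 - logistic (field n e x) = 1 / (1 + exp (field n e x))"
    using add_pos_pos[OF zero_less_one exp_gt_zero[of "field n e x"]]
    by (simp add: logistic_def divide_simps)
  then have "exp (h + field n e x) * (1 - logistic (field n e x)) = exp h * logistic (field n e x)"
    by (simp add: logistic_def exp_add)
  then have "exp (h + field n e x) / Z * (1 - logistic (field n e x))
      = exp h / Z * logistic (field n e x)" for Z
    by (simp add: field_simps)
  then show "pmf (\<pi> n) (x(e := True)) * (1 - logistic (field n e x))
      = pmf (\<pi> n) (x(e := False)) * logistic (field n e x)"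
    unfolding pmf_ergm mem[of True] h h_def[symmetric] by simp
qed (simp_all add: less_imp_le logistic_pos logistic_less_1 field_upd_same)

text \<open>A copy through \<open>e\<close> requires its other \<open>ne i - 1\<close> edges, which
  are distinct and hence independent under \<open>erdos_renyi n q\<close>.\<close>

lemma expectation_field:
  assumes "0 \<le> q" "q \<le> 1"
  shows "measure_pmf.expectation (erdos_renyi n q) (field n e)
    = (\<Sum>i=1..s. weight n i * (real (card (copies_through n (G i) e)) * q ^ (ne i - 1)))"
proof -
  note int = integrable_measure_pmf_finite[OF finite_set_pmf_erdos_renyi]
  have "measure_pmf.expectation (erdos_renyi n q)
      (\<lambda>y. real (card {\<psi> \<in> copies_through n (G i) e. \<forall>f\<in>(`) \<psi> ` edges (G i) - {e}. y f}))
      = real (card (copies_through n (G i) e)) * q ^ (ne i - 1)" if i: "i \<in> {1..s}" for i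
  proof -
    have one: "measure_pmf.expectation (erdos_renyi n q)
        (\<lambda>y. of_bool (\<forall>f\<in>(`) \<psi> ` edges (G i) - {e}. y f)) = q ^ (ne i - 1)"
      if \<psi>: "\<psi> \<in> copies_through n (G i) e" for \<psi>
    proof -
      have inj: "\<psi> \<in> injections (vertices (G i)) {1..n}" and e: "e \<in> (`) \<psi> ` edges (G i)"
        using \<psi> by (simp_all add: copies_through_def)
      have sub: "(`) \<psi> ` edges (G i) - {e} \<subseteq> complete_edges n"
        using image_edge_in_complete_edges[OF simple[OF i] inj] by auto
      have "card ((`) \<psi> ` edges (G i) - {e}) = ne i - 1"
        using card_image[OF inj_on_image_edges[OF simple[OF i] inj]] e
        by (subst card_Diff_singleton) simp_all
      then show ?thesis
        using expectation_erdos_renyi_subset[OF assms sub] by simp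
    qed
    have "real (card {\<psi> \<in> copies_through n (G i) e. \<forall>f\<in>(`) \<psi> ` edges (G i) - {e}. y f})
        = (\<Sum>\<psi>\<in>copies_through n (G i) e. of_bool (\<forall>f\<in>(`) \<psi> ` edges (G i) - {e}. y f))" for y
      using finite_copies_through[OF simple[OF i]]
      by (simp add: of_bool_def sum.If_cases Int_def)
    then show ?thesis
      by (simp add: one int del: of_bool_eq_iff)
  qed
  then show ?thesis
    unfolding field_altdef by (simp add: int)
qed

lemma expectation_field_le:
  assumes "0 \<le> q" "q \<le> 1" "n \<ge> 1" "e \<in> complete_edges n"
  shows "measure_pmf.expectation (erdos_renyi n q) (field n e) \<le> \<Psi> q"
  unfolding expectation_field[OF assms(1,2)] ergm_Psi_def
proof (rule sum_mono)
  fix i assume i: "i \<in> {1..s}"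
  show "weight n i * (real (card (copies_through n (G i) e)) * q ^ (ne i - 1))
      \<le> 2 * \<beta> i * real (ne i) * q ^ (ne i - 1)"
  proof (cases "edges (G i) = {}")
    case False
    have "real (card (copies_through n (G i) e)) \<le> real (2 * ne i * n ^ (nv i - 2))"
      using card_copies_through_le[OF simple[OF i] assms(4)] by (simp only: of_nat_le_iff)
    then have "weight n i * real (card (copies_through n (G i) e))
        \<le> weight n i * real (2 * ne i * n ^ (nv i - 2))"
      by (intro mult_left_mono weight_nonneg i)
    also have "\<dots> = 2 * \<beta> i * real (ne i)"
      using weight_mult_power[OF i False assms(3)] by simp
    finally show ?thesis
      using mult_right_mono[of _ _ "q ^ (ne i - 1)"] assms(1) by (simp only: mult.assoc[symmetric]) simp
  qed (simp add: copies_through_no_edges)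
qed

text \<open>Unlike the upper bound, this loses a term of order 1/n: injectivity makes the number of
  copies slightly smaller than the power of \<open>n\<close> that normalises it.\<close>

lemma expectation_field_ge:
  assumes "0 \<le> q" "q \<le> 1" "n \<ge> 1" "e \<in> complete_edges n"
  shows "\<Psi> q - (\<Sum>i=1..s. 2 * \<beta> i * real (ne i) * real (nv i) ^ 2) / real n
    \<le> measure_pmf.expectation (erdos_renyi n q) (field n e)"
  unfolding expectation_field[OF assms(1,2)] ergm_Psi_def sum_divide_distrib sum_subtractf[symmetric]
proof (rule sum_mono)
  fix i assume i: "i \<in> {1..s}"
  show "2 * \<beta> i * real (ne i) * q ^ (ne i - 1) - 2 * \<beta> i * real (ne i) * real (nv i) ^ 2 / real n
      \<le> weight n i * (real (card (copies_through n (G i) e)) * q ^ (ne i - 1))"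
  proof (cases "edges (G i) = {}")
    case False
    let ?m = "nv i - 2"
    \<comment> \<open>Bernoulli's inequality for the power of \<open>1 - nv i / n\<close>; when
      \<open>nv i\<close> exceeds \<open>n\<close> the left side is nonpositive.\<close>
    have "1 - real (nv i) ^ 2 / real n \<le> (real (n - nv i) / real n) ^ ?m"
    proof (cases "nv i \<le> n")
      case True
      have "real ?m * real (nv i) \<le> real (nv i) ^ 2"
        unfolding power2_eq_square by (intro mult_right_mono) auto
      then have "1 - real (nv i) ^ 2 / real n \<le> 1 + real ?m * (- (real (nv i) / real n))"
        using assms(3) by (simp add: divide_simps)
      also have "\<dots> \<le> (1 + - (real (nv i) / real n)) ^ ?m"
        using True assms(3) by (intro Bernoulli_inequality) simp
      also have "1 + - (real (nv i) / real n) = real (n - nv i) / real n"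
        using True assms(3) by (simp add: of_nat_diff field_simps)
      finally show ?thesis .
    next
      case False
      then have "real n * 1 \<le> real (nv i) * real (nv i)"
        by (intro mult_mono) auto
      then have "1 - real (nv i) ^ 2 / real n \<le> 0"
        using assms(3) by (simp add: power2_eq_square)
      then show ?thesis by (rule order.trans) simp
    qed
    then have "2 * \<beta> i * real (ne i) * (1 - real (nv i) ^ 2 / real n)
        \<le> 2 * \<beta> i * real (ne i) * (real (n - nv i) / real n) ^ ?m"
      using \<beta>_pos[OF i] by (intro mult_left_mono) auto
    also have "\<dots> = weight n i * real (2 * ne i * (n - nv i) ^ ?m)"
      using weight_mult_power[OF i False assms(3), symmetric] assms(3)
      by (simp add: power_divide)
    also have "\<dots> \<le> weight n i * real (card (copies_through n (G i) e))"
      using card_copies_through_ge[OF simple[OF i] assms(4)]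
      by (intro mult_left_mono weight_nonneg i) (simp only: of_nat_le_iff)
    finally have "2 * \<beta> i * real (ne i) * (1 - real (nv i) ^ 2 / real n) * q ^ (ne i - 1)
        \<le> weight n i * real (card (copies_through n (G i) e)) * q ^ (ne i - 1)"
      using assms(1) by (intro mult_right_mono) auto
    moreover have "2 * \<beta> i * real (ne i) * real (nv i) ^ 2 / real n * q ^ (ne i - 1)
        \<le> 2 * \<beta> i * real (ne i) * real (nv i) ^ 2 / real n"
      using \<beta>_pos[OF i] power_le_one[OF assms(1,2)] assms(1) by (intro mult_left_le) auto
    ultimately show ?thesis by (simp add: algebra_simps)
  qed (simp add: copies_through_no_edges)
qed

text \<open>A bound for the effect of edge \<open>f\<close> on the field at \<open>e\<close>,
  through the copies that cover both. The value 0 at \<open>f = e\<close> matters: the field ignores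
  its own edge, and the sum over all copies through \<open>e\<close> would be of order 1 instead of
  1/n.\<close>

definition influence :: "nat \<Rightarrow> nat set \<Rightarrow> nat set \<Rightarrow> real" where
  "influence n e f = (if f = e then 0
     else \<Sum>i=1..s. weight n i * real (card (copies_through n (G i) e \<inter> copies_through n (G i) f)))"

lemma influence_nonneg: "0 \<le> influence n e f"
  by (auto simp: influence_def intro!: sum_nonneg mult_nonneg_nonneg weight_nonneg)

lemma field_diff_le: "\<bar>field n e (y(f := True)) - field n e (y(f := False))\<bar> \<le> influence n e f"
proof (cases "f = e")
  case True
  then show ?thesis by (simp add: field_upd_same influence_def)
next
  case False
  define S where "S = (\<lambda>i b. {\<psi> \<in> copies_through n (G i) e. \<forall>g\<in>(`) \<psi> ` edges (G i) - {e}. (y(f := b)) g})"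
  define A where "A = (\<lambda>i. copies_through n (G i) e \<inter> copies_through n (G i) f)"
  have fin: "finite (S i b)" "finite (A i)" if "i \<in> {1..s}" for i b
    using finite_copies_through[OF simple[OF that]] by (simp_all add: S_def A_def)
  have "S i False \<subseteq> S i True" for i
    by (auto simp: S_def)
  moreover have "S i True \<subseteq> S i False \<union> A i" for i
  proof
    fix \<psi> assume \<psi>: "\<psi> \<in> S i True"
    show "\<psi> \<in> S i False \<union> A i"
    proof (cases "f \<in> (`) \<psi> ` edges (G i)")
      case True
      then show ?thesis using \<psi> by (simp add: S_def A_def copies_through_def)
    next
      case False
      then have "(y(f := True)) g = (y(f := False)) g" if "g \<in> (`) \<psi> ` edges (G i) - {e}" for g
        using that by (metis DiffD1 fun_upd_other)
      then have "\<psi> \<in> S i False"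
        using \<psi> unfolding S_def mem_Collect_eq by metis
      then show ?thesis ..
    qed
  qed
  ultimately have "\<bar>real (card (S i True)) - real (card (S i False))\<bar> \<le> real (card (A i))"
    if "i \<in> {1..s}" for i
    using fin[OF that] card_mono[of "S i True" "S i False"]
      card_mono[of "S i False \<union> A i" "S i True"] card_Un_le[of "S i False" "A i"]
    by force
  then have "\<bar>\<Sum>i=1..s. weight n i * (real (card (S i True)) - real (card (S i False)))\<bar>
      \<le> (\<Sum>i=1..s. weight n i * real (card (A i)))"
    by (intro order.trans[OF sum_abs] sum_mono)
       (simp add: abs_mult weight_nonneg mult_left_mono)
  moreover have "field n e (y(f := b)) = (\<Sum>i=1..s. weight n i * real (card (S i b)))" for b
    by (simp only: field_altdef S_def)
  ultimately show ?thesis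
    using False by (simp only: influence_def A_def if_False right_diff_distrib sum_subtractf)
qed

text \<open>Two distinct edges cost a third vertex, which leaves a factor 1/n after
  normalisation.\<close>

lemma influence_le:
  assumes "n \<ge> 1" "e \<in> complete_edges n" "f \<in> complete_edges n"
  shows "influence n e f \<le> (\<Sum>i=1..s. \<beta> i * real (nv i) ^ 3) / real n"
proof (cases "f = e")
  case True
  then show ?thesis
    by (simp add: influence_def)
       (intro divide_nonneg_nonneg sum_nonneg mult_nonneg_nonneg \<beta>_nonneg; simp)
next
  case False
  have "weight n i * real (card (copies_through n (G i) e \<inter> copies_through n (G i) f))
      \<le> \<beta> i * real (nv i) ^ 3 / real n" if i: "i \<in> {1..s}" for i
  proof (cases "edges (G i) = {}")
    case nonempty: False
    have "real (card (copies_through n (G i) e \<inter> copies_through n (G i) f) * n)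
        \<le> real (nv i ^ 3 * n ^ (nv i - 2))"
      using card_copies_through_Int_le[OF simple[OF i] assms(2,3)] False
      by (simp only: of_nat_le_iff)
    then have "weight n i * real (card (copies_through n (G i) e \<inter> copies_through n (G i) f) * n)
        \<le> weight n i * real (nv i ^ 3 * n ^ (nv i - 2))"
      by (intro mult_left_mono weight_nonneg i)
    also have "\<dots> = \<beta> i * real (nv i) ^ 3"
      using weight_mult_power[OF i nonempty assms(1)] by simp
    finally show ?thesis
      using assms(1) by (simp add: field_simps)
  qed (use \<beta>_pos[OF i] in \<open>simp add: copies_through_no_edges\<close>)
  then show ?thesis
    using False by (auto simp: influence_def sum_divide_distrib intro!: sum_mono)
qed

text \<open>Although \<open>f\<close> ranges over order n^2 edges, each copy through
  \<open>e\<close> meets only \<open>ne i\<close> of them, so the total stays bounded in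
  \<open>n\<close>.\<close>

lemma sum_influence_le:
  assumes "n \<ge> 1" "e \<in> complete_edges n"
  shows "(\<Sum>f\<in>complete_edges n. influence n e f) \<le> (\<Sum>i=1..s. 2 * \<beta> i * real (ne i) ^ 2)"
proof -
  have "(\<Sum>f\<in>complete_edges n. influence n e f) \<le> (\<Sum>f\<in>complete_edges n.
      \<Sum>i=1..s. weight n i * real (card (copies_through n (G i) e \<inter> copies_through n (G i) f)))"
    by (intro sum_mono) (auto simp: influence_def intro!: sum_nonneg mult_nonneg_nonneg weight_nonneg)
  also have "\<dots> = (\<Sum>i=1..s. weight n i * real (\<Sum>f\<in>complete_edges n.
      card (copies_through n (G i) e \<inter> copies_through n (G i) f)))"
    by (subst sum.swap) (simp add: sum_distrib_left)
  also have "\<dots> \<le> (\<Sum>i=1..s. 2 * \<beta> i * real (ne i) ^ 2)"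
  proof (rule sum_mono)
    fix i assume i: "i \<in> {1..s}"
    show "weight n i * real (\<Sum>f\<in>complete_edges n.
        card (copies_through n (G i) e \<inter> copies_through n (G i) f)) \<le> 2 * \<beta> i * real (ne i) ^ 2"
    proof (cases "edges (G i) = {}")
      case False
      have "(\<Sum>f\<in>complete_edges n. card (copies_through n (G i) e \<inter> copies_through n (G i) f))
          \<le> ne i * (2 * ne i * n ^ (nv i - 2))"
        unfolding sum_card_copies_through_Int[OF simple[OF i]]
        using card_copies_through_le[OF simple[OF i] assms(2)] by (rule mult_left_mono) simp
      then have "weight n i * real (\<Sum>f\<in>complete_edges n.
          card (copies_through n (G i) e \<inter> copies_through n (G i) f))
          \<le> weight n i * real (ne i * (2 * ne i * n ^ (nv i - 2)))"
        by (intro mult_left_mono weight_nonneg i) (simp only: of_nat_le_iff)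
      also have "\<dots> = 2 * \<beta> i * real (ne i) ^ 2"
        using weight_mult_power[OF i False assms(1)] by (simp add: power2_eq_square)
      finally show ?thesis .
    qed (simp add: copies_through_no_edges)
  qed
  finally show ?thesis .
qed

text \<open>The sum of squared influences is at most the maximum times the sum, hence O(1/n), and
  bounded differences apply with constants uniform in \<open>n\<close>, \<open>e\<close>,
  \<open>q\<close>. The bias \<open>K / real n\<close> appears only below, because the mean of the
  field never exceeds \<open>\<Psi> q\<close>.\<close>

lemma field_concentration:
  obtains c K where "c > 0" "K \<ge> 0"
    "\<And>n e q t. n \<ge> 1 \<Longrightarrow> e \<in> complete_edges n \<Longrightarrow> 0 \<le> q \<Longrightarrow> q \<le> 1 \<Longrightarrow> t \<ge> 0 \<Longrightarrow>
      measure_pmf.prob (erdos_renyi n q) {y. field n e y > \<Psi> q + t} \<le> exp (- (c * real n * t\<^sup>2))"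
    "\<And>n e q t. n \<ge> 1 \<Longrightarrow> e \<in> complete_edges n \<Longrightarrow> 0 \<le> q \<Longrightarrow> q \<le> 1 \<Longrightarrow> t \<ge> 0 \<Longrightarrow>
      measure_pmf.prob (erdos_renyi n q) {y. field n e y < \<Psi> q - K / real n - t}
        \<le> exp (- (c * real n * t\<^sup>2))"
proof
  define C1 C2 where "C1 = (\<Sum>i=1..s. \<beta> i * real (nv i) ^ 3)"
    and "C2 = (\<Sum>i=1..s. 2 * \<beta> i * real (ne i) ^ 2)"
  \<comment> \<open>The summand 1 keeps the variance proxy positive when all graphs are edgeless and
    \<open>C2 = 0\<close>.\<close>
  define c where "c = 2 / (C1 * C2 + 1)"
  have "C1 \<ge> 0" "C2 \<ge> 0"
    unfolding C1_def C2_def by (auto intro!: sum_nonneg mult_nonneg_nonneg \<beta>_nonneg)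
  then have C: "C1 * C2 + 1 > 0" by (simp add: add_nonneg_pos)
  then show "c > 0" by (simp add: c_def)
  define K where "K = (\<Sum>i=1..s. 2 * \<beta> i * real (ne i) * real (nv i) ^ 2)"
  show "K \<ge> 0"
    unfolding K_def by (auto intro!: sum_nonneg mult_nonneg_nonneg \<beta>_nonneg)
  fix n e and q t :: real
  assume n: "n \<ge> 1" and e: "e \<in> complete_edges n" and q: "0 \<le> q" "q \<le> 1" and t: "t \<ge> 0"
  have "(\<Sum>f\<in>complete_edges n. (influence n e f)\<^sup>2) \<le> (\<Sum>f\<in>complete_edges n. C1 / n * influence n e f)"
    unfolding power2_eq_square C1_def
    by (intro sum_mono mult_right_mono influence_le influence_nonneg n e)
  also have "\<dots> \<le> C1 / n * C2"
    unfolding sum_distrib_left[symmetric] C2_def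
    using \<open>C1 \<ge> 0\<close> by (intro mult_left_mono sum_influence_le n e) simp
  also have "\<dots> \<le> (C1 * C2 + 1) / n"
    by (simp add: divide_right_mono)
  finally have S: "(\<Sum>f\<in>complete_edges n. (influence n e f)\<^sup>2) \<le> (C1 * C2 + 1) / n" .
  have exp_eq: "exp (- (2 * t\<^sup>2 / ((C1 * C2 + 1) / n))) = exp (- (c * real n * t\<^sup>2))"
    by (simp add: c_def)
  let ?E = "measure_pmf.expectation (erdos_renyi n q) (field n e)"
  have "measure_pmf.prob (erdos_renyi n q) {y. field n e y > \<Psi> q + t}
      \<le> measure_pmf.prob (erdos_renyi n q) {y. field n e y > ?E + t}"
    using expectation_field_le[OF q n e] by (intro measure_pmf.finite_measure_mono) auto
  also have "\<dots> \<le> exp (- (2 * t\<^sup>2 / ((C1 * C2 + 1) / n)))"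
    unfolding erdos_renyi_def
    by (rule Pi_pmf_bernoulli_tail[OF _ q field_diff_le S]) (use C n t in auto)
  finally show "measure_pmf.prob (erdos_renyi n q) {y. field n e y > \<Psi> q + t}
      \<le> exp (- (c * real n * t\<^sup>2))"
    unfolding exp_eq .
  have "measure_pmf.prob (erdos_renyi n q) {y. field n e y < \<Psi> q - K / real n - t}
      \<le> measure_pmf.prob (erdos_renyi n q)
          {y. - field n e y > measure_pmf.expectation (erdos_renyi n q) (\<lambda>y. - field n e y) + t}"
    using expectation_field_ge[OF q n e] by (intro measure_pmf.finite_measure_mono) (auto simp: K_def)
  also have "\<dots> \<le> exp (- (2 * t\<^sup>2 / ((C1 * C2 + 1) / n)))"
    unfolding erdos_renyi_def
    by (rule Pi_pmf_bernoulli_tail[OF _ q _ S])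
       (use C n t field_diff_le in \<open>auto simp: abs_minus_commute simp del: fun_upd_apply\<close>)
  finally show "measure_pmf.prob (erdos_renyi n q) {y. field n e y < \<Psi> q - K / real n - t}
      \<le> exp (- (c * real n * t\<^sup>2))"
    unfolding exp_eq .
qed

end

section \<open>Comparison with Erdos-Renyi graphs\<close>

context ergm_model
begin

text \<open>The expected number of edges with X_e = 1 and Y_e = 0 in the coupling with
  \<open>erdos_renyi n q\<close>, expressed through the ERGM alone; \<open>deficit\<close> counts
  the opposite disagreements.\<close>

definition excess :: "nat \<Rightarrow> real \<Rightarrow> real" where
  "excess n q = (\<Sum>e\<in>complete_edges n.
     measure_pmf.expectation (\<pi> n) (\<lambda>x. max (logistic (field n e x) - q) 0))"

definition deficit :: "nat \<Rightarrow> real \<Rightarrow> real" where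
  "deficit n q = (\<Sum>e\<in>complete_edges n.
     measure_pmf.expectation (\<pi> n) (\<lambda>x. max (q - logistic (field n e x)) 0))"

lemma excess_nonneg: "0 \<le> excess n q"
  unfolding excess_def by (intro sum_nonneg integral_nonneg) simp

lemma deficit_nonneg: "0 \<le> deficit n q"
  unfolding deficit_def by (intro sum_nonneg integral_nonneg) simp

text \<open>Start of the descent: at \<open>q = 1\<close> the comparison graph is complete and
  dominates trivially.\<close>

lemma excess_1: "excess n 1 = 0"
  using logistic_less_1 unfolding excess_def by (simp add: max_def not_le less_imp_le)

lemma deficit_0: "deficit n 0 = 0"
  using logistic_pos unfolding deficit_def by (simp add: max_def not_le less_imp_le)

text \<open>One coupling realises both quantities, so they can be used separately for domination and
  added for the Wasserstein distance.\<close>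

lemma glauber_coupling:
  assumes "0 \<le> q" "q \<le> 1"
  obtains \<Gamma> where "\<Gamma> \<in> couplings (\<pi> n) (erdos_renyi n q)"
    and "(\<Sum>e\<in>complete_edges n. measure_pmf.prob \<Gamma> {(x, y). x e \<and> \<not> y e}) = excess n q"
    and "(\<Sum>e\<in>complete_edges n. measure_pmf.prob \<Gamma> {(x, y). \<not> x e \<and> y e}) = deficit n q"
proof -
  have "\<exists>\<Gamma>\<in>couplings (\<pi> n) (erdos_renyi n q). \<forall>e\<in>complete_edges n.
    pmf (map_pmf (\<lambda>(x, y). (x e, y e)) \<Gamma>) (True, False)
      = measure_pmf.expectation (\<pi> n) (\<lambda>x. max (logistic (field n e x) - q) 0) \<and>
    pmf (map_pmf (\<lambda>(x, y). (x e, y e)) \<Gamma>) (False, True)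
      = measure_pmf.expectation (\<pi> n) (\<lambda>x. max (q - logistic (field n e x)) 0)"
    by (rule heat_bath_sweep)
       (use assms in \<open>simp_all add: less_imp_le logistic_pos logistic_less_1
          ergm_heat_bath erdos_renyi_heat_bath\<close>)
  then obtain \<Gamma> where \<Gamma>: "\<Gamma> \<in> couplings (\<pi> n) (erdos_renyi n q)"
    and probs: "\<And>e. e \<in> complete_edges n \<Longrightarrow> pmf (map_pmf (\<lambda>(x, y). (x e, y e)) \<Gamma>) (True, False)
      = measure_pmf.expectation (\<pi> n) (\<lambda>x. max (logistic (field n e x) - q) 0)"
      "\<And>e. e \<in> complete_edges n \<Longrightarrow> pmf (map_pmf (\<lambda>(x, y). (x e, y e)) \<Gamma>) (False, True)
      = measure_pmf.expectation (\<pi> n) (\<lambda>x. max (q - logistic (field n e x)) 0)"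
    by blast
  have vimage: "(\<lambda>(x, y). (x e, y e)) -` {(True, False)} = {(x, y). x e \<and> \<not> y e}"
    "(\<lambda>(x, y). (x e, y e)) -` {(False, True)} = {(x, y). \<not> x e \<and> y e}" for e :: "nat set"
    by auto
  show thesis
    by (rule that[OF \<Gamma>])
       (simp_all add: excess_def deficit_def pmf_map vimage flip: probs)
qed

text \<open>Unless some edge violates the order, \<open>field_mono\<close> carries a large field
  from X to Y; by the union bound a violation has probability at most the expected number of
  violations.\<close>

lemma prob_ergm_le_excess:
  assumes q: "0 \<le> q" "q \<le> 1"
  shows "measure_pmf.prob (\<pi> n) {x. field n e x > u}
    \<le> excess n q + measure_pmf.prob (erdos_renyi n q) {y. field n e y > u}"
proof -
  obtain \<Gamma> where \<Gamma>: "\<Gamma> \<in> couplings (\<pi> n) (erdos_renyi n q)"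
    and ex: "(\<Sum>e\<in>complete_edges n. measure_pmf.prob \<Gamma> {(x, y). x e \<and> \<not> y e}) = excess n q"
    using glauber_coupling[OF q] by blast
  have marginals: "\<pi> n = map_pmf fst \<Gamma>" "erdos_renyi n q = map_pmf snd \<Gamma>"
    using \<Gamma> by (auto simp: couplings_def)
  have "{z. field n e (fst z) > u} \<subseteq>
      (\<Union>f\<in>complete_edges n. {(x, y). x f \<and> \<not> y f}) \<union> {z. field n e (snd z) > u}"
  proof
    fix z :: "config \<times> config" assume z: "z \<in> {z. field n e (fst z) > u}"
    show "z \<in> (\<Union>f\<in>complete_edges n. {(x, y). x f \<and> \<not> y f}) \<union> {z. field n e (snd z) > u}"
    proof (cases "\<forall>f\<in>complete_edges n. fst z f \<longrightarrow> snd z f")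
      case True
      then have "field n e (fst z) \<le> field n e (snd z)"
        by (intro field_mono) blast
      then show ?thesis using z by simp
    qed (cases z, auto)
  qed
  then have "measure_pmf.prob \<Gamma> {z. field n e (fst z) > u}
      \<le> measure_pmf.prob \<Gamma> ((\<Union>f\<in>complete_edges n. {(x, y). x f \<and> \<not> y f}) \<union> {z. field n e (snd z) > u})"
    by (intro measure_pmf.finite_measure_mono) auto
  also have "\<dots> \<le> measure_pmf.prob \<Gamma> (\<Union>f\<in>complete_edges n. {(x, y). x f \<and> \<not> y f})
      + measure_pmf.prob \<Gamma> {z. field n e (snd z) > u}"
    by (rule measure_Un_le) auto
  also have "measure_pmf.prob \<Gamma> (\<Union>f\<in>complete_edges n. {(x, y). x f \<and> \<not> y f}) \<le> excess n q"
    unfolding ex[symmetric] by (rule measure_pmf.finite_measure_subadditive_finite) auto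
  finally show ?thesis
    by (simp add: marginals vimage_def)
qed

lemma prob_ergm_le_deficit:
  assumes q: "0 \<le> q" "q \<le> 1"
  shows "measure_pmf.prob (\<pi> n) {x. field n e x < u}
    \<le> deficit n q + measure_pmf.prob (erdos_renyi n q) {y. field n e y < u}"
proof -
  obtain \<Gamma> where \<Gamma>: "\<Gamma> \<in> couplings (\<pi> n) (erdos_renyi n q)"
    and de: "(\<Sum>e\<in>complete_edges n. measure_pmf.prob \<Gamma> {(x, y). \<not> x e \<and> y e}) = deficit n q"
    using glauber_coupling[OF q] by blast
  have marginals: "\<pi> n = map_pmf fst \<Gamma>" "erdos_renyi n q = map_pmf snd \<Gamma>"
    using \<Gamma> by (auto simp: couplings_def)
  have "{z. field n e (fst z) < u} \<subseteq>
      (\<Union>f\<in>complete_edges n. {(x, y). \<not> x f \<and> y f}) \<union> {z. field n e (snd z) < u}"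
  proof
    fix z :: "config \<times> config" assume z: "z \<in> {z. field n e (fst z) < u}"
    show "z \<in> (\<Union>f\<in>complete_edges n. {(x, y). \<not> x f \<and> y f}) \<union> {z. field n e (snd z) < u}"
    proof (cases "\<forall>f\<in>complete_edges n. snd z f \<longrightarrow> fst z f")
      case True
      then have "field n e (snd z) \<le> field n e (fst z)"
        by (intro field_mono) blast
      then show ?thesis using z by simp
    qed (cases z, auto)
  qed
  then have "measure_pmf.prob \<Gamma> {z. field n e (fst z) < u}
      \<le> measure_pmf.prob \<Gamma> ((\<Union>f\<in>complete_edges n. {(x, y). \<not> x f \<and> y f}) \<union> {z. field n e (snd z) < u})"
    by (intro measure_pmf.finite_measure_mono) auto
  also have "\<dots> \<le> measure_pmf.prob \<Gamma> (\<Union>f\<in>complete_edges n. {(x, y). \<not> x f \<and> y f})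
      + measure_pmf.prob \<Gamma> {z. field n e (snd z) < u}"
    by (rule measure_Un_le) auto
  also have "measure_pmf.prob \<Gamma> (\<Union>f\<in>complete_edges n. {(x, y). \<not> x f \<and> y f}) \<le> deficit n q"
    unfolding de[symmetric] by (rule measure_pmf.finite_measure_subadditive_finite) auto
  finally show ?thesis
    by (simp add: marginals vimage_def)
qed

lemma card_complete_edges_le: "real (card (complete_edges n)) \<le> (real n)\<^sup>2"
proof -
  have "n choose 2 \<le> n * (n - 1)" by (simp add: choose_two)
  also have "\<dots> \<le> n ^ 2" by (simp add: power2_eq_square)
  finally have "n choose 2 \<le> n ^ 2" .
  then show ?thesis by (simp add: card_complete_edges flip: of_nat_power)
qed

lemma excess_step:
  assumes q: "0 \<le> q" "q \<le> 1" and q': "0 \<le> q'" "logistic u \<le> q'" and "0 \<le> b"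
    and tail: "\<And>e. e \<in> complete_edges n \<Longrightarrow>
      measure_pmf.prob (erdos_renyi n q) {y. field n e y > u} \<le> b"
  shows "excess n q' \<le> (real n)\<^sup>2 * (excess n q + b)"
proof -
  have "measure_pmf.expectation (\<pi> n) (\<lambda>x. max (logistic (field n e x) - q') 0) \<le> excess n q + b"
    if e: "e \<in> complete_edges n" for e
  proof -
    have "measure_pmf.expectation (\<pi> n) (\<lambda>x. max (logistic (field n e x) - q') 0)
        \<le> measure_pmf.expectation (\<pi> n) (indicator {x. field n e x > u})"
    proof (intro integral_mono integrable_measure_pmf_finite finite_set_pmf_ergm)
      fix x
      \<comment> \<open>Where the field exceeds \<open>u\<close>, the positive part is below 1
        because \<open>q'\<close> is nonnegative; elsewhere it vanishes, since
        \<open>logistic\<close> is increasing and \<open>logistic u \<le> q'\<close>.\<close>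
      show "max (logistic (field n e x) - q') 0 \<le> indicator {x. field n e x > u} x"
        using logistic_diff_le(1)[of "field n e x" u] logistic_less_1[of "field n e x"] q'
        by (auto simp: indicator_def)
    qed
    also have "\<dots> = measure_pmf.prob (\<pi> n) {x. field n e x > u}" by simp
    also have "\<dots> \<le> excess n q + b"
      using prob_ergm_le_excess[OF q, where n = n and e = e and u = u] tail[OF e] by simp
    finally show ?thesis .
  qed
  then have "excess n q' \<le> real (card (complete_edges n)) * (excess n q + b)"
    unfolding excess_def[of n q'] by (rule sum_bounded_above)
  also have "\<dots> \<le> (real n)\<^sup>2 * (excess n q + b)"
    using excess_nonneg[of n q] \<open>0 \<le> b\<close> by (intro mult_right_mono card_complete_edges_le) auto
  finally show ?thesis .
qed

lemma deficit_step:
  assumes q: "0 \<le> q" "q \<le> 1" and q': "q' \<le> 1" "q' \<le> logistic u" and "0 \<le> b"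
    and tail: "\<And>e. e \<in> complete_edges n \<Longrightarrow>
      measure_pmf.prob (erdos_renyi n q) {y. field n e y < u} \<le> b"
  shows "deficit n q' \<le> (real n)\<^sup>2 * (deficit n q + b)"
proof -
  have "measure_pmf.expectation (\<pi> n) (\<lambda>x. max (q' - logistic (field n e x)) 0) \<le> deficit n q + b"
    if e: "e \<in> complete_edges n" for e
  proof -
    have "measure_pmf.expectation (\<pi> n) (\<lambda>x. max (q' - logistic (field n e x)) 0)
        \<le> measure_pmf.expectation (\<pi> n) (indicator {x. field n e x < u})"
    proof (intro integral_mono integrable_measure_pmf_finite finite_set_pmf_ergm)
      fix x
      show "max (q' - logistic (field n e x)) 0 \<le> indicator {x. field n e x < u} x"
        using logistic_diff_le(1)[of u "field n e x"] logistic_pos[of "field n e x"] q'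
        by (auto simp: indicator_def)
    qed
    also have "\<dots> = measure_pmf.prob (\<pi> n) {x. field n e x < u}" by simp
    also have "\<dots> \<le> deficit n q + b"
      using prob_ergm_le_deficit[OF q, where n = n and e = e and u = u] tail[OF e] by simp
    finally show ?thesis .
  qed
  then have "deficit n q' \<le> real (card (complete_edges n)) * (deficit n q + b)"
    unfolding deficit_def[of n q'] by (rule sum_bounded_above)
  also have "\<dots> \<le> (real n)\<^sup>2 * (deficit n q + b)"
    using deficit_nonneg[of n q] \<open>0 \<le> b\<close> by (intro mult_right_mono card_complete_edges_le) auto
  finally show ?thesis .
qed

text \<open>The positive part is 1-Lipschitz in \<open>q\<close>. Applied once, from the stopping
  distance to the fixed point, this produces the final rate.\<close>

lemma excess_shift:
  assumes "d \<ge> 0"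
  shows "excess n q \<le> excess n (q + d) + (real n)\<^sup>2 * d"
proof -
  note int = integrable_measure_pmf_finite[OF finite_set_pmf_ergm]
  have "excess n q \<le> (\<Sum>e\<in>complete_edges n.
      measure_pmf.expectation (\<pi> n) (\<lambda>x. max (logistic (field n e x) - (q + d)) 0 + d))"
    unfolding excess_def using assms by (intro sum_mono integral_mono int) auto
  also have "\<dots> = excess n (q + d) + real (card (complete_edges n)) * d"
    by (simp add: excess_def int sum.distrib)
  finally show ?thesis
    using mult_right_mono[OF card_complete_edges_le[of n] assms] by simp
qed

lemma deficit_shift:
  assumes "d \<ge> 0"
  shows "deficit n q \<le> deficit n (q - d) + (real n)\<^sup>2 * d"
proof -
  note int = integrable_measure_pmf_finite[OF finite_set_pmf_ergm]
  have "deficit n q \<le> (\<Sum>e\<in>complete_edges n.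
      measure_pmf.expectation (\<pi> n) (\<lambda>x. max (q - d - logistic (field n e x)) 0 + d))"
    unfolding deficit_def using assms by (intro sum_mono integral_mono int) auto
  also have "\<dots> = deficit n (q - d) + real (card (complete_edges n)) * d"
    by (simp add: deficit_def int sum.distrib)
  finally show ?thesis
    using mult_right_mono[OF card_complete_edges_le[of n] assms] by simp
qed

lemma wasserstein_le_excess_deficit:
  assumes "0 \<le> q" "q \<le> 1"
  shows "wasserstein n (\<pi> n) (erdos_renyi n q) \<le> excess n q + deficit n q"
proof -
  obtain \<Gamma> where \<Gamma>: "\<Gamma> \<in> couplings (\<pi> n) (erdos_renyi n q)"
    and ex: "(\<Sum>e\<in>complete_edges n. measure_pmf.prob \<Gamma> {(x, y). x e \<and> \<not> y e}) = excess n q"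
    and de: "(\<Sum>e\<in>complete_edges n. measure_pmf.prob \<Gamma> {(x, y). \<not> x e \<and> y e}) = deficit n q"
    using glauber_coupling[OF assms] by blast
  have "{(x, y). x e \<noteq> y e} = {(x, y). x e \<and> \<not> y e} \<union> {(x, y). \<not> x e \<and> y e}" for e :: "nat set"
    by auto
  then have "measure_pmf.prob \<Gamma> {(x, y). x e \<noteq> y e}
      \<le> measure_pmf.prob \<Gamma> {(x, y). x e \<and> \<not> y e} + measure_pmf.prob \<Gamma> {(x, y). \<not> x e \<and> y e}" for e
    using measure_Un_le[of "{(x, y). x e \<and> \<not> y e}" \<Gamma> "{(x, y). \<not> x e \<and> y e}"] by simp
  then have "(\<Sum>e\<in>complete_edges n. measure_pmf.prob \<Gamma> {(x, y). x e \<noteq> y e})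
      \<le> excess n q + deficit n q"
    unfolding ex[symmetric] de[symmetric] sum.distrib[symmetric] by (rule sum_mono)
  with wasserstein_le[OF \<Gamma>] show ?thesis by (rule order.trans)
qed

section \<open>The mean-field map and its global contraction towards the fixed point\<close>

lemma phi_differentiable: "\<exists>D. (ergm_phi s G \<beta> has_real_derivative D) (at q)"
proof -
  have "\<Psi> differentiable (at q)"
    unfolding ergm_Psi_def by (intro derivative_intros) auto
  then obtain D where "(\<Psi> has_real_derivative D) (at q)"
    by (auto simp: real_differentiable_def)
  then have "((\<lambda>q. logistic (\<Psi> q)) has_real_derivative
      (logistic (\<Psi> q) * (1 - logistic (\<Psi> q))) * D) (at q)"
    by (rule DERIV_chain2[OF logistic_has_derivative])
  then show ?thesis
    by (auto simp: ergm_phi_def[abs_def])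
qed

lemma isCont_phi: "isCont (ergm_phi s G \<beta>) q"
  using phi_differentiable DERIV_isCont by blast

lemma phi_bounds: "0 < ergm_phi s G \<beta> q" "ergm_phi s G \<beta> q < 1"
  by (simp_all add: ergm_phi_def logistic_pos logistic_less_1)

text \<open>The difference quotient at \<open>p\<close> is continuous on [0,1] and everywhere below
  1: at \<open>p\<close> by the slope condition, elsewhere because uniqueness keeps the graph of the
  map from recrossing the diagonal. Compactness then yields one constant below 1.\<close>

lemma phi_contraction:
  assumes fp: "unique_fixed_point s G \<beta> p" and deriv: "deriv (ergm_phi s G \<beta>) p < 1"
  obtains \<rho> where "0 \<le> \<rho>" "\<rho> < 1"
    "\<And>q. 0 \<le> q \<Longrightarrow> q \<le> 1 \<Longrightarrow> \<bar>ergm_phi s G \<beta> q - p\<bar> \<le> \<rho> * \<bar>q - p\<bar>"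
proof -
  let ?\<phi> = "ergm_phi s G \<beta>"
  have p: "0 < p" "?\<phi> p = p" "p < 1" and unique: "\<And>q. q > 0 \<Longrightarrow> ?\<phi> q = q \<Longrightarrow> q = p"
    using fp phi_bounds[of p] by (auto simp: unique_fixed_point_def)
  obtain D where D: "(?\<phi> has_real_derivative D) (at p)"
    using phi_differentiable by blast
  then have "D < 1" using deriv by (simp add: DERIV_imp_deriv)
  \<comment> \<open>Caratheodory's form of differentiability: \<open>g\<close> is the difference
    quotient, completed by \<open>D\<close> at \<open>p\<close>.\<close>
  obtain g where g: "\<And>q. ?\<phi> q - ?\<phi> p = g q * (q - p)" "isCont g p" "g p = D"
    using D unfolding CARAT_DERIV by blast
  have cont: "isCont g q" for q
  proof (cases "q = p")
    case False
    have "isCont (\<lambda>q. (?\<phi> q - ?\<phi> p) / (q - p)) q"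
      using False isCont_phi by (intro continuous_intros) auto
    moreover have "\<forall>\<^sub>F z in nhds q. g z = (?\<phi> z - ?\<phi> p) / (z - p)"
      using t1_space_nhds[OF False] by eventually_elim (use g(1) in \<open>simp add: field_simps\<close>)
    ultimately show ?thesis by (simp add: isCont_cong)
  qed (use g in simp)
  have cont_diff: "continuous_on A (\<lambda>z. z - ?\<phi> z)" for A
    using isCont_phi by (intro continuous_intros continuous_at_imp_continuous_on) auto
  have less: "g q < 1" if q: "0 \<le> q" "q \<le> 1" for q
  proof -
    consider "q = p" | "p < q" | "q < p" by linarith
    then show ?thesis
    proof cases
      case 1
      then show ?thesis using g \<open>D < 1\<close> by simp
    next
      case 2
      have "?\<phi> q < q"
      proof (rule ccontr)
        assume "\<not> ?\<phi> q < q"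
        \<comment> \<open>Since the map is below 1 at 1, failure at \<open>q\<close> would force a
          second fixed point in [q,1].\<close>
        then have "\<exists>r. q \<le> r \<and> r \<le> 1 \<and> r - ?\<phi> r = 0"
          using q phi_bounds(2)[of 1] by (intro IVT' cont_diff) auto
        then obtain r where r: "q \<le> r" "?\<phi> r = r" by auto
        then show False using unique[of r] 2 p(1) by simp
      qed
      then have "g q * (q - p) < 1 * (q - p)"
        using g(1)[of q] p by simp
      then show ?thesis using 2 by simp
    next
      case 3
      have "q < ?\<phi> q"
      proof (rule ccontr)
        assume "\<not> q < ?\<phi> q"
        then have "\<exists>r. 0 \<le> r \<and> r \<le> q \<and> r - ?\<phi> r = 0"
          using q phi_bounds(1)[of 0] by (intro IVT' cont_diff) auto
        then obtain r where r: "0 \<le> r" "r \<le> q" "?\<phi> r = r" by auto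
        \<comment> \<open>Uniqueness speaks of positive fixed points; a fixed point is positive
          because the map is.\<close>
        then have "r > 0" using phi_bounds(1)[of r] by simp
        then show False using unique[of r] r 3 by simp
      qed
      then have "1 * (q - p) < g q * (q - p)"
        using g(1)[of q] p by simp
      then show ?thesis using 3 by simp
    qed
  qed
  have mono: "0 \<le> g q" if q: "0 \<le> q" "q \<noteq> p" for q
  proof -
    have mono_phi: "?\<phi> a \<le> ?\<phi> b" if "0 \<le> a" "a \<le> b" for a b
    proof -
      have "\<Psi> a \<le> \<Psi> b"
        unfolding ergm_Psi_def using that
        by (intro sum_mono mult_left_mono power_mono) (auto simp: \<beta>_nonneg)
      then show ?thesis using logistic_diff_le(1) by (simp add: ergm_phi_def)
    qed
    show ?thesis
    proof (cases "p < q")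
      case True
      then have "0 \<le> g q * (q - p)" using mono_phi[of p q] g(1)[of q] p by simp
      then show ?thesis using True by (simp add: zero_le_mult_iff)
    next
      case False
      then have "g q * (q - p) \<le> 0" "q < p" using mono_phi[of q p] g(1)[of q] p q by simp_all
      then show ?thesis by (simp add: mult_le_0_iff)
    qed
  qed
  obtain m where m: "0 \<le> m" "m \<le> 1" "\<And>q. 0 \<le> q \<Longrightarrow> q \<le> 1 \<Longrightarrow> g q \<le> g m"
    using continuous_attains_sup[of "{0..1::real}" g] cont
    by (auto simp: continuous_at_imp_continuous_on)
  show thesis
  \<comment> \<open>The maximum with 0 secures a nonnegative rate even if \<open>m = p\<close>,
    where \<open>mono\<close> gives no sign.\<close>
  proof (rule that[of "max (g m) 0"])
    fix q :: real assume q: "0 \<le> q" "q \<le> 1"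
    show "\<bar>?\<phi> q - p\<bar> \<le> max (g m) 0 * \<bar>q - p\<bar>"
    proof (cases "q = p")
      case False
      have "\<bar>?\<phi> q - p\<bar> = g q * \<bar>q - p\<bar>"
        using g(1)[of q] p mono[OF q(1) False] by (simp add: abs_mult)
      also have "\<dots> \<le> max (g m) 0 * \<bar>q - p\<bar>"
        using m(3)[OF q] by (intro mult_right_mono) auto
      finally show ?thesis .
    qed (simp add: p)
  qed (use less m in auto)
qed

end

text \<open>
  Since the tolerance shrinks in proportion to the distance to the fixed point, the union bound
  over all edges at each step is absorbed by the gain from \<^term>\<open>\<epsilon> * \<rho> ^ k\<close>
  to \<^term>\<open>\<epsilon> * \<rho> ^ Suc k\<close> in the exponent.
\<close>

lemma geometric_error_recursion:
  fixes a :: "nat \<Rightarrow> real" and n :: nat and \<rho> c A \<epsilon> :: real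
  assumes "0 < \<rho>" "\<rho> < 1" "c > 0" "n \<ge> 2" "A > 0" and A: "c * (1 - \<rho>\<^sup>2) * A \<ge> 3"
    and start: "a 0 \<le> 0"
    and step: "\<And>k. A * ln n \<le> n * (\<epsilon> * \<rho> ^ k)\<^sup>2 \<Longrightarrow>
      a (Suc k) \<le> (real n)\<^sup>2 * (a k + exp (- (c * n * (\<epsilon> * \<rho> ^ k)\<^sup>2)))"
  shows "\<exists>k. a k \<le> 1 \<and> \<epsilon> * \<rho> ^ k \<le> sqrt (A * ln n / n)"
proof -
  define r where "r = (\<lambda>k. n * (\<epsilon> * \<rho> ^ k)\<^sup>2)"
  have ln: "ln n > 0" using assms by simp
  have r_Suc: "r (Suc k) = \<rho>\<^sup>2 * r k" for k
    by (simp add: r_def power_mult_distrib)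
  have "(\<lambda>k. n * (\<epsilon> * \<rho> ^ k)\<^sup>2) \<longlonglongrightarrow> n * (\<epsilon> * 0)\<^sup>2"
    using assms by (intro tendsto_intros LIMSEQ_power_zero) auto
  then have "\<forall>\<^sub>F k in sequentially. r k < A * ln n"
    using ln \<open>A > 0\<close> unfolding r_def by (intro order_tendstoD(2)) auto
  then have ex: "\<exists>k. r k < A * ln n"
    by (auto simp: eventually_sequentially)
  \<comment> \<open>The first index at which the tolerance is below the threshold;
    \<open>step\<close> is available at every earlier one.\<close>
  define K where "K = (LEAST k. r k < A * ln n)"
  have K: "r K < A * ln n" unfolding K_def using ex by (rule LeastI_ex)
  have before: "A * ln n \<le> r k" if "k < K" for k
    using not_less_Least[of k "\<lambda>k. r k < A * ln n"] that by (simp add: K_def)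
  \<comment> \<open>The invariant: the accumulated error never exceeds the tail term of the current
    tolerance.\<close>
  have "a k \<le> exp (- (c * r k))" if "k \<le> K" for k
    using that
  proof (induction k)
    case 0
    then show ?case using start by (simp add: order.trans)
  next
    case (Suc k)
    then have k: "A * ln n \<le> r k" using before by simp
    have "3 * ln n \<le> c * (1 - \<rho>\<^sup>2) * A * ln n"
      using A ln by simp
    also have "\<dots> \<le> c * (1 - \<rho>\<^sup>2) * r k"
      using mult_left_mono[OF k, of "c * (1 - \<rho>\<^sup>2)"] assms by (simp add: power_le_one mult_ac)
    finally have "exp (3 * ln n) \<le> exp (c * (1 - \<rho>\<^sup>2) * r k)"
      by simp
    moreover have "exp (3 * ln n) = (real n) ^ 3"
      using assms by (simp add: exp_of_nat_mult[of 3, simplified])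
    ultimately have n3: "(real n) ^ 3 \<le> exp (c * (1 - \<rho>\<^sup>2) * r k)" by simp
    have "a (Suc k) \<le> (real n)\<^sup>2 * (a k + exp (- (c * r k)))"
      using step[of k] k by (simp add: r_def mult.assoc)
    also have "\<dots> \<le> (real n)\<^sup>2 * (2 * exp (- (c * r k)))"
      using Suc by (intro mult_left_mono) auto
    \<comment> \<open>The factor 2 is absorbed by \<open>n \<ge> 2\<close>; this third power is the
      origin of the 3 in the condition on \<open>A\<close>.\<close>
    also have "\<dots> \<le> (real n) ^ 3 * exp (- (c * r k))"
      using assms by (simp add: power3_eq_cube power2_eq_square)
    also have "\<dots> \<le> exp (c * (1 - \<rho>\<^sup>2) * r k) * exp (- (c * r k))"
      using n3 by (rule mult_right_mono) simp
    also have "\<dots> = exp (- (c * r (Suc k)))"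
      by (simp add: r_Suc algebra_simps flip: exp_add)
    finally show ?case .
  qed
  then have "a K \<le> exp (- (c * r K))" by simp
  also have "\<dots> \<le> 1" using \<open>c > 0\<close> by (simp add: r_def)
  finally have "a K \<le> 1" .
  moreover have "\<epsilon> * \<rho> ^ K \<le> sqrt (A * ln n / n)"
    using K assms by (intro real_le_rsqrt) (simp add: r_def field_simps)
  ultimately show ?thesis by blast
qed

section \<open>Assembling the rate\<close>

context ergm_model
begin

lemma wasserstein_ergm_erdos_renyi:
  assumes fp: "unique_fixed_point s G \<beta> p" and deriv: "deriv (ergm_phi s G \<beta>) p < 1"
  shows "\<exists>C>0. \<forall>\<^sub>F n in sequentially.
    wasserstein n (\<pi> n) (erdos_renyi n p) \<le> C * real n powr (3 / 2) * sqrt (ln (real n))"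
proof -
  let ?\<phi> = "ergm_phi s G \<beta>"
  have p: "0 < p" "p < 1"
    using fp phi_bounds[of p] by (auto simp: unique_fixed_point_def)
  obtain \<rho>0 where \<rho>0: "0 \<le> \<rho>0" "\<rho>0 < 1"
    and contract: "\<And>q. 0 \<le> q \<Longrightarrow> q \<le> 1 \<Longrightarrow> \<bar>?\<phi> q - p\<bar> \<le> \<rho>0 * \<bar>q - p\<bar>"
    using phi_contraction[OF fp deriv] by blast
  obtain c K where "c > 0" "K \<ge> 0"
    and upper: "\<And>n e q t. n \<ge> 1 \<Longrightarrow> e \<in> complete_edges n \<Longrightarrow> 0 \<le> q \<Longrightarrow> q \<le> 1 \<Longrightarrow> t \<ge> 0 \<Longrightarrow>
      measure_pmf.prob (erdos_renyi n q) {y. field n e y > \<Psi> q + t} \<le> exp (- (c * real n * t\<^sup>2))"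
    and lower: "\<And>n e q t. n \<ge> 1 \<Longrightarrow> e \<in> complete_edges n \<Longrightarrow> 0 \<le> q \<Longrightarrow> q \<le> 1 \<Longrightarrow> t \<ge> 0 \<Longrightarrow>
      measure_pmf.prob (erdos_renyi n q) {y. field n e y < \<Psi> q - K / real n - t}
        \<le> exp (- (c * real n * t\<^sup>2))"
    using field_concentration by blast
  define \<rho> where "\<rho> = (1 + \<rho>0) / 2"
  \<comment> \<open>The slack between \<open>\<rho>0\<close> and \<open>\<rho>\<close> is split in
    two: one \<open>\<eta>\<close> pays for the tolerance \<open>\<eta> * \<epsilon>\<close> in the
    field, the other for the bias \<open>K / n\<close> of the lower tail. Hence the rate
    \<open>c * \<eta>\<^sup>2\<close> in terms of \<open>\<epsilon>\<close>.\<close>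
  define \<eta> where "\<eta> = (\<rho> - \<rho>0) / 2"
  have \<rho>: "0 < \<rho>" "\<rho> < 1" and \<eta>: "\<eta> > 0" and split: "\<rho>0 + \<eta> + \<eta> = \<rho>"
    using \<rho>0 by (simp_all add: \<rho>_def \<eta>_def field_simps)
  define c' where "c' = c * \<eta>\<^sup>2"
  have "c' > 0" using \<open>c > 0\<close> \<eta> by (simp add: c'_def)
  have "1 - \<rho>\<^sup>2 > 0" using \<rho> by (simp add: power_less_one_iff abs_square_less_1)
  define A where "A = 3 / (c' * (1 - \<rho>\<^sup>2))"
  have A: "A > 0" "c' * (1 - \<rho>\<^sup>2) * A \<ge> 3"
    using \<open>c' > 0\<close> \<open>1 - \<rho>\<^sup>2 > 0\<close> by (simp_all add: A_def)
  have pow: "0 \<le> \<rho> ^ k" "\<rho> ^ k \<le> 1" for k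
    using \<rho> by (simp_all add: power_le_one)
  \<comment> \<open>The bound 3 gives \<open>ln n \<ge> 1\<close>; the other ensures
    \<open>K / n \<le> \<eta> * \<epsilon>\<close> as long as \<open>\<epsilon>\<close> is above the
    threshold of the recursion.\<close>
  define N where "N = max 3 (nat \<lceil>K\<^sup>2 / (\<eta>\<^sup>2 * A)\<rceil>)"
  have bound: "wasserstein n (\<pi> n) (erdos_renyi n p)
      \<le> (2 + 2 * sqrt A) * real n powr (3 / 2) * sqrt (ln (real n))" if "n \<ge> N" for n
  proof -
    have n: "n \<ge> 3" using that by (simp add: N_def)
    have "K\<^sup>2 / (\<eta>\<^sup>2 * A) \<le> real n"
      using that by (simp add: N_def)
    then have Kn: "K\<^sup>2 \<le> real n * (\<eta>\<^sup>2 * A)"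
      using \<eta> A(1) by (simp add: divide_le_eq)
    have ln1: "1 \<le> ln (real n)"
      using n exp_le by (subst ln_ge_iff) auto
    have tail_exp: "exp (- (c * real n * (\<eta> * \<epsilon>)\<^sup>2)) = exp (- (c' * n * \<epsilon>\<^sup>2))" for \<epsilon>
      by (simp add: c'_def power_mult_distrib)
    \<comment> \<open>At \<open>k = 0\<close> the parameter is 1, where the excess vanishes.\<close>
    have "\<exists>k. excess n (p + (1 - p) * \<rho> ^ k) \<le> 1 \<and> (1 - p) * \<rho> ^ k \<le> sqrt (A * ln n / n)"
    proof (rule geometric_error_recursion[OF \<rho> \<open>c' > 0\<close> _ A])
      fix k
      define \<epsilon> where "\<epsilon> = (1 - p) * \<rho> ^ k"
      have \<epsilon>: "0 \<le> \<epsilon>" "p + \<epsilon> \<le> 1"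
      proof -
        have "(1 - p) * \<rho> ^ k \<le> 1 - p"
          using p pow[of k] by (intro mult_left_le) auto
        then show "0 \<le> \<epsilon>" "p + \<epsilon> \<le> 1"
          using p pow[of k] unfolding \<epsilon>_def by (simp, linarith)
      qed
      have next_eq: "p + (1 - p) * \<rho> ^ Suc k = p + (\<rho>0 + \<eta> + \<eta>) * \<epsilon>"
        by (simp add: \<epsilon>_def split)
      have "logistic (\<Psi> (p + \<epsilon>) + \<eta> * \<epsilon>) \<le> ?\<phi> (p + \<epsilon>) + \<eta> * \<epsilon>"
        using logistic_diff_le(2)[of "\<Psi> (p + \<epsilon>)" "\<Psi> (p + \<epsilon>) + \<eta> * \<epsilon>"] \<epsilon>(1) \<eta>
        by (simp add: ergm_phi_def)
      also have "\<dots> \<le> p + \<rho>0 * \<epsilon> + \<eta> * \<epsilon>"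
        using contract[of "p + \<epsilon>"] p \<epsilon> by simp
      also have "\<dots> \<le> p + (\<rho>0 + \<eta> + \<eta>) * \<epsilon>"
        using \<epsilon>(1) \<eta> by (simp add: ring_distribs)
      finally have step: "logistic (\<Psi> (p + \<epsilon>) + \<eta> * \<epsilon>) \<le> p + (\<rho>0 + \<eta> + \<eta>) * \<epsilon>" .
      have "excess n (p + (\<rho>0 + \<eta> + \<eta>) * \<epsilon>)
          \<le> (real n)\<^sup>2 * (excess n (p + \<epsilon>) + exp (- (c * real n * (\<eta> * \<epsilon>)\<^sup>2)))"
        by (rule excess_step[OF _ \<epsilon>(2) _ step])
           (use p \<epsilon> \<eta> \<rho>0 n in \<open>auto intro!: upper add_nonneg_nonneg mult_nonneg_nonneg\<close>)
      then show "excess n (p + (1 - p) * \<rho> ^ Suc k) \<le> (real n)\<^sup>2 *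
          (excess n (p + (1 - p) * \<rho> ^ k) + exp (- (c' * n * ((1 - p) * \<rho> ^ k)\<^sup>2)))"
        unfolding next_eq tail_exp by (simp only: \<epsilon>_def)
    qed (use n in \<open>simp_all add: excess_1\<close>)
    then obtain k1 where k1: "excess n (p + (1 - p) * \<rho> ^ k1) \<le> 1"
      "(1 - p) * \<rho> ^ k1 \<le> sqrt (A * ln n / n)" by blast
    \<comment> \<open>At \<open>k = 0\<close> the parameter is 0, where the deficit
      vanishes.\<close>
    have "\<exists>k. deficit n (p - p * \<rho> ^ k) \<le> 1 \<and> p * \<rho> ^ k \<le> sqrt (A * ln n / n)"
    proof (rule geometric_error_recursion[OF \<rho> \<open>c' > 0\<close> _ A])
      fix k
      assume "A * ln n \<le> n * (p * \<rho> ^ k)\<^sup>2"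
      define \<epsilon> where "\<epsilon> = p * \<rho> ^ k"
      have \<epsilon>: "0 \<le> \<epsilon>" "\<epsilon> \<le> p"
        using p pow[of k] by (auto simp: \<epsilon>_def mult_left_le)
      have "A * 1 \<le> A * ln n" using ln1 A(1) by (intro mult_left_mono) auto
      then have "A \<le> n * \<epsilon>\<^sup>2"
        using \<open>A * ln n \<le> n * (p * \<rho> ^ k)\<^sup>2\<close> by (simp add: \<epsilon>_def)
      then have "real n * (\<eta>\<^sup>2 * A) \<le> real n * (\<eta>\<^sup>2 * (n * \<epsilon>\<^sup>2))"
        by (intro mult_left_mono) auto
      then have "K\<^sup>2 \<le> (real n * (\<eta> * \<epsilon>))\<^sup>2"
        using Kn by (simp add: power_mult_distrib power2_eq_square mult_ac)
      then have "K \<le> real n * (\<eta> * \<epsilon>)"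
        by (rule power2_le_imp_le) (use \<epsilon> \<eta> in simp)
      then have bias: "K / n \<le> \<eta> * \<epsilon>"
        using n by (simp add: divide_le_eq mult.commute)
      have next_eq: "p - p * \<rho> ^ Suc k = p - (\<rho>0 + \<eta> + \<eta>) * \<epsilon>"
        by (simp add: \<epsilon>_def split)
      let ?u = "\<Psi> (p - \<epsilon>) - K / n - \<eta> * \<epsilon>"
      have "\<bar>?\<phi> (p - \<epsilon>) - p\<bar> \<le> \<rho>0 * \<epsilon>"
        using contract[of "p - \<epsilon>"] p \<epsilon> by simp
      then have "p - (\<rho>0 + \<eta> + \<eta>) * \<epsilon> \<le> ?\<phi> (p - \<epsilon>) - K / n - \<eta> * \<epsilon>"
        using bias unfolding ring_distribs by linarith
      also have "\<dots> \<le> logistic ?u"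
      proof -
        have "0 \<le> K / n" "0 \<le> \<eta> * \<epsilon>"
          using \<epsilon>(1) \<eta> \<open>K \<ge> 0\<close> by simp_all
        then show ?thesis
          using logistic_diff_le(2)[of ?u "\<Psi> (p - \<epsilon>)"] unfolding ergm_phi_def by linarith
      qed
      finally have step: "p - (\<rho>0 + \<eta> + \<eta>) * \<epsilon> \<le> logistic ?u" .
      have le1: "p - (\<rho>0 + \<eta> + \<eta>) * \<epsilon> \<le> 1"
        using p \<rho> \<epsilon>(1) split by (smt (verit) mult_nonneg_nonneg)
      have "deficit n (p - (\<rho>0 + \<eta> + \<eta>) * \<epsilon>)
          \<le> (real n)\<^sup>2 * (deficit n (p - \<epsilon>) + exp (- (c * real n * (\<eta> * \<epsilon>)\<^sup>2)))"
        by (rule deficit_step[OF _ _ le1 step])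
           (use p \<epsilon> \<eta> n in \<open>auto intro!: lower\<close>)
      then show "deficit n (p - p * \<rho> ^ Suc k) \<le> (real n)\<^sup>2 *
          (deficit n (p - p * \<rho> ^ k) + exp (- (c' * n * (p * \<rho> ^ k)\<^sup>2)))"
        unfolding next_eq tail_exp by (simp only: \<epsilon>_def)
    qed (use n in \<open>simp_all add: deficit_0\<close>)
    then obtain k2 where k2: "deficit n (p - p * \<rho> ^ k2) \<le> 1"
      "p * \<rho> ^ k2 \<le> sqrt (A * ln n / n)" by blast
    have "excess n p \<le> 1 + (real n)\<^sup>2 * sqrt (A * ln n / n)"
      using excess_shift[of "(1 - p) * \<rho> ^ k1" n p] p pow[of k1] k1
        mult_left_mono[OF k1(2), of "(real n)\<^sup>2"] by simp
    moreover have "deficit n p \<le> 1 + (real n)\<^sup>2 * sqrt (A * ln n / n)"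
      using deficit_shift[of "p * \<rho> ^ k2" n p] p pow[of k2] k2
        mult_left_mono[OF k2(2), of "(real n)\<^sup>2"] by simp
    ultimately have "wasserstein n (\<pi> n) (erdos_renyi n p)
        \<le> 2 + 2 * ((real n)\<^sup>2 * sqrt (A * ln n / n))"
      using wasserstein_le_excess_deficit[of p n] p by simp
    also have "(real n)\<^sup>2 * sqrt (A * ln n / n) = sqrt A * (real n powr (3 / 2) * sqrt (ln n))"
    proof -
      have "(real n)\<^sup>2 / sqrt n = real n powr 2 / real n powr (1 / 2)"
        using n by (simp add: powr_half_sqrt)
      also have "\<dots> = real n powr (3 / 2)"
        unfolding powr_diff[symmetric] by simp
      finally have "real n powr (3 / 2) = (real n)\<^sup>2 / sqrt n" ..
      then show ?thesis
        by (simp add: real_sqrt_mult real_sqrt_divide)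
    qed
    \<comment> \<open>The additive 2, from the two errors left at the stopping distance, is absorbed
      because the rate is at least 1.\<close>
    also have "2 + 2 * (sqrt A * (real n powr (3 / 2) * sqrt (ln n)))
        \<le> (2 + 2 * sqrt A) * real n powr (3 / 2) * sqrt (ln n)"
    proof -
      have "1 * 1 \<le> real n powr (3 / 2) * sqrt (ln n)"
        using n ln1 by (intro mult_mono ge_one_powr_ge_zero) auto
      then show ?thesis by (simp add: algebra_simps)
    qed
    finally show ?thesis .
  qed
  have "2 + 2 * sqrt A > 0" using A(1) by (simp add: add_pos_pos)
  then show ?thesis
    using bound unfolding eventually_sequentially by blast
qed

end

theorem theorem3:
  fixes s :: nat
    and G :: "nat \<Rightarrow> 'v graph"
    and \<beta> :: "nat \<Rightarrow> real"
    and p_star :: real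
  assumes "s \<ge> 1"
    and "\<And>i. i \<in> {1..s} \<Longrightarrow> finite_simple_graph (G i)"
    and "\<And>i. i \<in> {1..s} \<Longrightarrow> \<beta> i > 0"
    and "high_temperature s G \<beta>"
    and "unique_fixed_point s G \<beta> p_star"
  shows "\<exists>C>0. \<forall>\<^sub>F n in sequentially.
           wasserstein n (ergm s G \<beta> n) (erdos_renyi n p_star)
             \<le> C * real n powr (3 / 2) * sqrt (ln (real n))"
proof -
  interpret ergm_model s G \<beta>
    using assms(2,3) by unfold_locales
  \<comment> \<open>\<open>high_temperature\<close> brings its own fixed point, which uniqueness
    identifies with \<open>p_star\<close>.\<close>
  have "deriv (ergm_phi s G \<beta>) p_star < 1"
    using assms(4,5) by (auto simp: high_temperature_def unique_fixed_point_def)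
  with assms(5) show ?thesis
    by (rule wasserstein_ergm_erdos_renyi)
qed

end
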